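(* Let $0\le\omega<\mu\le\pi$ and let $T\in\Omega$ be a right-linear operator on the two-sided quaternionic Banach space $V$ with $\mathbb S\subseteq\rho_S(T)$. Let $f\in\mathcal F_L(\mathcal S_\mu^0)$ and let $k,k'$ be nonnegative integers both admissible for $f$. Then $$\psi_k(T)^{-1}(\psi_k f)(T)=\psi_{k'}(T)^{-1}(\psi_{k'} f)(T)$$ as operators (including domains); i.e. the H^\infty functional calculus $f(T)$ does not depend on the choice of the regularizing intrinsic rational function.
   Context: $\mathbb H$ denotes the quaternions, $\mathbb S=\{q\in\mathbb H:q^2=-1\}$ the sphere of imaginary units, and for $i\in\mathbb S$, $\mathbb C_i=\{u+iv:u,v\in\mathbb R\}$. $V$ is a two-sided quaternionic Banach space, $\mathcal B(V)$ the bounded right-linear operators on $V$, $\mathcal I$ the identity. For a closed right-linear operator $T:\mathcal D(T)\subseteq V\to V$: $\rho_S(T)=\{s\in\mathbb H:(T^2-2\mathrm{Re}(s)T+|s|^2\mathcal I)^{-1}\in\mathcal B(V)\}$ (the operator $T^2-2\mathrm{Re}(s)T+|s|^2\mathcal I$ acting on $\mathcal D(T^2)$), $\sigma_S(T)=\mathbb H\setminus\rho_S(T)$; for $s\in\rho_S(T)$, $Q_s(T)=(T^2-2\mathrm{Re}(s)T+|s|^2\mathcal I)^{-1}$, $S_L^{-1}(s,T)=Q_s(T)\bar s-TQ_s(T)$, $S_R^{-1}(s,T)=-(T-\mathcal I\bar s)Q_s(T)$. Slice hyperholomorphy: a real differentiable $f:U\to\mathbb H$ on open $U\subseteq\mathbb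 H$ is left slice hyperholomorphic if for every $i\in\mathbb S$ its restriction $f_i$ to $U\cap\mathbb C_i$ satisfies $\frac12(\partial_u f_i(u+iv)+i\,\partial_v f_i(u+iv))=0$, right slice hyperholomorphic if $\frac12(\partial_u f_i(u+iv)+\partial_v f_i(u+iv)\,i)=0$, and intrinsic if it is left (or right) slice hyperholomorphic and $f(U\cap\mathbb C_i)\subseteq\mathbb C_i$ for all $i\in\mathbb S$. For $s\in\mathbb H\setminus\{0\}$, $\arg(s)\in[0,\pi]$ is the unique $\theta$ with $s=|s|e^{\theta i_s}$, where $i_s=\mathrm{Im}(s)/|\mathrm{Im}(s)|$ if $\mathrm{Im}(s)\ne0$ (any $i_s\in\mathbb S$ if $s$ is real). For $\vartheta\in[0,\pi]$: $\mathcal S_\vartheta=\{s\in\mathbb H: s=0 \text{ or } \arg(s)\le\vartheta\}$, $\mathcal S_\vartheta^0=\{s\in\mathbb H\setminus\{0\}:\arg(s)<\vartheta\}$. Operator of type $\omega$ ($\omega\in[0,\pi)$): a closed, densely defined right-linear operator $T$ with $\sigma_S(T)\subseteq\mathcal S_\omega$ such that for every $\vartheta\in(\omega,\pi]$ there is $C_\vartheta>0$ with $\|S_L^{-1}(s,T)\|\le C_\vartheta/|s|$ and $\|S_R^{-1}(s,T)\|\le C_\vartheta/|s|$ for all nonzero $s\in\mathbb H\setminus\mathcal S_\vartheta$. $\Omega$ is the set of operators of type $\omega$ that are injective with dense range. Function classes: $\Psi_L(\mathcal S_\mu^0)$ is the set of left slice hyperholomorphic $f$ on $\mathcal S_\mu^0$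 with $|f(s)|\le c|s|^\alpha/(1+|s|^{2\alpha})$ on $\mathcal S^0_\mu$ for some $\alpha,c>0$. $\mathcal F_L(\mathcal S^0_\mu)$ (resp. $\mathcal F(\mathcal S^0_\mu)$) is the set of left slice hyperholomorphic (resp. intrinsic) $f$ on $\mathcal S^0_\mu$ with $|f(s)|\le C(|s|^k+|s|^{-k})$ on $\mathcal S^0_\mu$ for some $k>0$, $C>0$. S-functional calculus: for $\psi\in\Psi_L(\mathcal S_\mu^0)$, $\psi(T):=\frac{1}{2\pi}\int_\Gamma S_L^{-1}(s,T)\,ds_i\,\psi(s)$, $ds_i=-i\,ds$, where $i\in\mathbb S$ and $\Gamma\subseteq\mathbb C_i$ is a piecewise smooth path which, for some $\theta'\in(\omega,\mu)$, satisfies $\Gamma\setminus\{0\}\subseteq\mathcal S^0_\mu\setminus\mathcal S_{\theta'}$ and outside a ball coincides with the rays $re^{\pm i\theta}$ ($\theta\in(\omega,\mu)$), oriented from $\infty e^{i\theta}$ to $\infty e^{-i\theta}$; this is a bounded operator independent of $\Gamma$ and $i$. Regularizers: $\psi_k(s)=\big(s/(1+s^2)\big)^{k+1}$ for $k\in\mathbb N\cup\{0\}$ (an intrinsic rational function). If $\mathbb S\subseteq\rho_S(T)$ then $(\mathcal I+T^2)^{-1}\in\mathcal B(V)$ and $\psi_k(T):=\big(T(\mathcal I+T^2)^{-1}\big)^{k+1}\in\mathcal B(V)$, which is injective when $T$ is. A nonnegative integer $k$ is admissible for $f\in\mathcal F_L(\mathcal S^0_\mu)$ if the pointwise product $\psi_kf$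 belongs to $\Psi_L(\mathcal S^0_\mu)$. The H^\infty functional calculus is $f(T):=\psi_k(T)^{-1}(\psi_kf)(T)$ for an admissible $k$, with domain $\{v\in V:(\psi_kf)(T)v\in\mathrm{Ran}\,\psi_k(T)\}$. *)

theory Defs
  imports "HOL-Analysis.Analysis"
begin

text \<open>A quaternion a + b j with a, b complex (a, b in span of 1 and i) is represented by the
pair (a, b).  The product structure of complex x complex gives exactly the Euclidean norm
and topology of R^4.\<close>

type_synonym quat = "complex \<times> complex"

definition qmul :: "quat \<Rightarrow> quat \<Rightarrow> quat" where
  "qmul p q = (fst p * fst q - snd p * cnj (snd q), fst p * snd q + snd p * cnj (fst q))"

definition qcnj :: "quat \<Rightarrow> quat" where
  "qcnj q = (cnj (fst q), - snd q)"

definition qof_real :: "real \<Rightarrow> quat" where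
  "qof_real r = (complex_of_real r, 0)"

definition qone :: quat where
  "qone = qof_real 1"

definition qRe :: "quat \<Rightarrow> real" where
  "qRe q = Re (fst q)"

definition qinv :: "quat \<Rightarrow> quat" where
  "qinv q = (1 / (norm q)^2) *\<^sub>R qcnj q"

definition qi :: quat where
  "qi = (\<i>, 0)"

definition qpow :: "quat \<Rightarrow> nat \<Rightarrow> quat" where
  "qpow x n = ((qmul x) ^^ n) qone"

definition qS :: "quat set" where
  "qS = {q. qmul q q = - qone}"

definition slice_pt :: "quat \<Rightarrow> real \<Rightarrow> real \<Rightarrow> quat" where
  "slice_pt i u v = qof_real u + v *\<^sub>R i"

definition qexp :: "real \<Rightarrow> quat \<Rightarrow> quat" where
  "qexp \<theta> i = qof_real (cos \<theta>) + sin \<theta> *\<^sub>R i"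

definition left_slice_hol :: "quat set \<Rightarrow> (quat \<Rightarrow> quat) \<Rightarrow> bool" where
  "left_slice_hol U f \<longleftrightarrow> open U \<and> f differentiable_on U \<and>
     (\<forall>i\<in>qS. \<forall>u v. slice_pt i u v \<in> U \<longrightarrow>
        (1/2) *\<^sub>R (vector_derivative (\<lambda>t. f (slice_pt i t v)) (at u)
                  + qmul i (vector_derivative (\<lambda>t. f (slice_pt i u t)) (at v))) = 0)"

definition qarg :: "quat \<Rightarrow> real" where
  "qarg s = (THE \<theta>. 0 \<le> \<theta> \<and> \<theta> \<le> pi \<and> (\<exists>i\<in>qS. s = norm s *\<^sub>R qexp \<theta> i))"

definition sector :: "real \<Rightarrow> quat set" where
  "sector \<theta> = {s. s = 0 \<or> qarg s \<le> \<theta>}"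

definition sector0 :: "real \<Rightarrow> quat set" where
  "sector0 \<theta> = {s. s \<noteq> 0 \<and> qarg s < \<theta>}"

definition two_sided_qbanach ::
  "(quat \<Rightarrow> 'v::banach \<Rightarrow> 'v) \<Rightarrow> ('v \<Rightarrow> quat \<Rightarrow> 'v) \<Rightarrow> bool" where
  "two_sided_qbanach lm rm \<longleftrightarrow>
     (\<forall>p q v. lm (p + q) v = lm p v + lm q v) \<and>
     (\<forall>q u v. lm q (u + v) = lm q u + lm q v) \<and>
     (\<forall>p q v. lm (qmul p q) v = lm p (lm q v)) \<and>
     (\<forall>v. lm qone v = v) \<and>
     (\<forall>p q v. rm v (p + q) = rm v p + rm v q) \<and>
     (\<forall>q u v. rm (u + v) q = rm u q + rm v q) \<and>
     (\<forall>p q v. rm v (qmul p q) = rm (rm v p) q) \<and>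
     (\<forall>v. rm v qone = v) \<and>
     (\<forall>p q v. lm p (rm v q) = rm (lm p v) q) \<and>
     (\<forall>r v. lm (qof_real r) v = r *\<^sub>R v \<and> rm v (qof_real r) = r *\<^sub>R v) \<and>
     (\<forall>q v. norm (lm q v) = norm q * norm v \<and> norm (rm v q) = norm q * norm v)"

text \<open>A (possibly unbounded) operator is a pair (D, T) of a domain D and a map T, whose values
outside D are irrelevant.\<close>

definition right_subspace :: "('v::real_vector \<Rightarrow> quat \<Rightarrow> 'v) \<Rightarrow> 'v set \<Rightarrow> bool" where
  "right_subspace rm D \<longleftrightarrow> 0 \<in> D \<and> (\<forall>u\<in>D. \<forall>v\<in>D. u + v \<in> D) \<and> (\<forall>v\<in>D. \<forall>q. rm v q \<in> D)"

definition right_linear_op ::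
  "('v::real_vector \<Rightarrow> quat \<Rightarrow> 'v) \<Rightarrow> 'v set \<Rightarrow> ('v \<Rightarrow> 'v) \<Rightarrow> bool" where
  "right_linear_op rm D T \<longleftrightarrow> right_subspace rm D \<and>
     (\<forall>u\<in>D. \<forall>v\<in>D. T (u + v) = T u + T v) \<and> (\<forall>v\<in>D. \<forall>q. T (rm v q) = rm (T v) q)"

definition closed_op :: "'v::real_normed_vector set \<Rightarrow> ('v \<Rightarrow> 'v) \<Rightarrow> bool" where
  "closed_op D T \<longleftrightarrow> closed {(v, T v) | v. v \<in> D}"

definition bounded_op :: "('v::real_normed_vector \<Rightarrow> quat \<Rightarrow> 'v) \<Rightarrow> ('v \<Rightarrow> 'v) \<Rightarrow> bool" where
  "bounded_op rm A \<longleftrightarrow> bounded_linear A \<and> (\<forall>v q. A (rm v q) = rm (A v) q)"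

definition dom2 :: "'v set \<Rightarrow> ('v \<Rightarrow> 'v) \<Rightarrow> 'v set" where
  "dom2 D T = {v \<in> D. T v \<in> D}"

definition Qop :: "('v::real_vector \<Rightarrow> 'v) \<Rightarrow> quat \<Rightarrow> 'v \<Rightarrow> 'v" where
  "Qop T s v = T (T v) - (2 * qRe s) *\<^sub>R T v + (norm s)^2 *\<^sub>R v"

definition is_Qinv :: "('v::real_normed_vector \<Rightarrow> quat \<Rightarrow> 'v) \<Rightarrow> 'v set \<Rightarrow> ('v \<Rightarrow> 'v)
    \<Rightarrow> quat \<Rightarrow> ('v \<Rightarrow> 'v) \<Rightarrow> bool" where
  "is_Qinv rm D T s Q \<longleftrightarrow> bounded_op rm Q \<and>
     (\<forall>v. Q v \<in> dom2 D T \<and> Qop T s (Q v) = v) \<and>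
     (\<forall>v\<in>dom2 D T. Q (Qop T s v) = v)"

definition S_resolvent_set :: "('v::real_normed_vector \<Rightarrow> quat \<Rightarrow> 'v) \<Rightarrow> 'v set
    \<Rightarrow> ('v \<Rightarrow> 'v) \<Rightarrow> quat set" where
  "S_resolvent_set rm D T = {s. \<exists>Q. is_Qinv rm D T s Q}"

definition S_spectrum :: "('v::real_normed_vector \<Rightarrow> quat \<Rightarrow> 'v) \<Rightarrow> 'v set
    \<Rightarrow> ('v \<Rightarrow> 'v) \<Rightarrow> quat set" where
  "S_spectrum rm D T = UNIV - S_resolvent_set rm D T"

definition Qs :: "('v::real_normed_vector \<Rightarrow> quat \<Rightarrow> 'v) \<Rightarrow> 'v set \<Rightarrow> ('v \<Rightarrow> 'v)
    \<Rightarrow> quat \<Rightarrow> 'v \<Rightarrow> 'v" where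
  "Qs rm D T s = (THE Q. is_Qinv rm D T s Q)"

text \<open>S_L^{-1}(s,T) = Q_s(T) conj(s) - T Q_s(T) and S_R^{-1}(s,T) = -(T - I conj(s)) Q_s(T),
where for A in B(V) and a quaternion q, (A q) v = A (q v).\<close>
definition SL :: "(quat \<Rightarrow> 'v::real_normed_vector \<Rightarrow> 'v) \<Rightarrow> ('v \<Rightarrow> quat \<Rightarrow> 'v) \<Rightarrow> 'v set
    \<Rightarrow> ('v \<Rightarrow> 'v) \<Rightarrow> quat \<Rightarrow> 'v \<Rightarrow> 'v" where
  "SL lm rm D T s v = Qs rm D T s (lm (qcnj s) v) - T (Qs rm D T s v)"

definition SR :: "(quat \<Rightarrow> 'v::real_normed_vector \<Rightarrow> 'v) \<Rightarrow> ('v \<Rightarrow> quat \<Rightarrow> 'v) \<Rightarrow> 'v set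
    \<Rightarrow> ('v \<Rightarrow> 'v) \<Rightarrow> quat \<Rightarrow> 'v \<Rightarrow> 'v" where
  "SR lm rm D T s v = - (T (Qs rm D T s v) - lm (qcnj s) (Qs rm D T s v))"

definition op_of_type :: "(quat \<Rightarrow> 'v::banach \<Rightarrow> 'v) \<Rightarrow> ('v \<Rightarrow> quat \<Rightarrow> 'v) \<Rightarrow> 'v set
    \<Rightarrow> ('v \<Rightarrow> 'v) \<Rightarrow> real \<Rightarrow> bool" where
  "op_of_type lm rm D T \<omega> \<longleftrightarrow>
     right_linear_op rm D T \<and> closed_op D T \<and> closure D = UNIV \<and>
     S_spectrum rm D T \<subseteq> sector \<omega> \<and>
     (\<forall>\<theta>. \<omega> < \<theta> \<and> \<theta> \<le> pi \<longrightarrow>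
        (\<exists>C>0. \<forall>s. s \<noteq> 0 \<and> s \<notin> sector \<theta> \<longrightarrow>
           (\<forall>v. norm (SL lm rm D T s v) \<le> C / norm s * norm v) \<and>
           (\<forall>v. norm (SR lm rm D T s v) \<le> C / norm s * norm v)))"

definition op_in_Omega :: "(quat \<Rightarrow> 'v::banach \<Rightarrow> 'v) \<Rightarrow> ('v \<Rightarrow> quat \<Rightarrow> 'v) \<Rightarrow> 'v set
    \<Rightarrow> ('v \<Rightarrow> 'v) \<Rightarrow> real \<Rightarrow> bool" where
  "op_in_Omega lm rm D T \<omega> \<longleftrightarrow>
     op_of_type lm rm D T \<omega> \<and> inj_on T D \<and> closure (T ` D) = UNIV"

definition Psi_L :: "real \<Rightarrow> (quat \<Rightarrow> quat) set" where
  "Psi_L \<mu> = {f. left_slice_hol (sector0 \<mu>) f \<and>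
     (\<exists>\<alpha>>0. \<exists>c>0. \<forall>s\<in>sector0 \<mu>.
        norm (f s) \<le> c * norm s powr \<alpha> / (1 + norm s powr (2 * \<alpha>)))}"

definition F_L :: "real \<Rightarrow> (quat \<Rightarrow> quat) set" where
  "F_L \<mu> = {f. left_slice_hol (sector0 \<mu>) f \<and>
     (\<exists>k>0. \<exists>C>0. \<forall>s\<in>sector0 \<mu>.
        norm (f s) \<le> C * (norm s powr k + norm s powr (- k)))}"

text \<open>psi(T) v = 1/(2 pi) int_Gamma S_L^{-1}(s,T) ds_i psi(s) v, with ds_i = -i ds.  We take the
imaginary unit qi and the contour Gamma consisting of the two rays r e^{+- i theta}, r > 0,
theta = (omega + mu)/2, oriented from infinity e^{i theta} to infinity e^{-i theta}.  (The paper
shows the result is independent of these choices.)\<close>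
definition S_calc :: "(quat \<Rightarrow> 'v::banach \<Rightarrow> 'v) \<Rightarrow> ('v \<Rightarrow> quat \<Rightarrow> 'v) \<Rightarrow> 'v set
    \<Rightarrow> ('v \<Rightarrow> 'v) \<Rightarrow> real \<Rightarrow> real \<Rightarrow> (quat \<Rightarrow> quat) \<Rightarrow> 'v \<Rightarrow> 'v" where
  "S_calc lm rm D T \<omega> \<mu> \<psi> v =
     (let \<theta> = (\<omega> + \<mu>) / 2; e1 = qexp \<theta> qi; e2 = qexp (- \<theta>) qi in
      (1 / (2 * pi)) *\<^sub>R
        (integral {0<..} (\<lambda>r::real. SL lm rm D T (r *\<^sub>R e2) (lm (qmul (- qi) (qmul e2 (\<psi> (r *\<^sub>R e2)))) v))
       - integral {0<..} (\<lambda>r::real. SL lm rm D T (r *\<^sub>R e1) (lm (qmul (- qi) (qmul e1 (\<psi> (r *\<^sub>R e1)))) v))))"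

definition psi_fun :: "nat \<Rightarrow> quat \<Rightarrow> quat" where
  "psi_fun k s = qpow (qmul s (qinv (qone + qmul s s))) (k + 1)"

text \<open>psi_k(T) = (T (I + T^2)^{-1})^(k+1), where (I + T^2)^{-1} = Q_i(T) for the unit i.\<close>
definition psi_op :: "('v::real_normed_vector \<Rightarrow> quat \<Rightarrow> 'v) \<Rightarrow> 'v set \<Rightarrow> ('v \<Rightarrow> 'v)
    \<Rightarrow> nat \<Rightarrow> 'v \<Rightarrow> 'v" where
  "psi_op rm D T k = ((\<lambda>v. T (Qs rm D T qi v)) ^^ (k + 1))"

definition admissible :: "real \<Rightarrow> nat \<Rightarrow> (quat \<Rightarrow> quat) \<Rightarrow> bool" where
  "admissible \<mu> k f \<longleftrightarrow> (\<lambda>s. qmul (psi_fun k s) (f s)) \<in> Psi_L \<mu>"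

definition Hinf_calc :: "(quat \<Rightarrow> 'v::banach \<Rightarrow> 'v) \<Rightarrow> ('v \<Rightarrow> quat \<Rightarrow> 'v) \<Rightarrow> 'v set
    \<Rightarrow> ('v \<Rightarrow> 'v) \<Rightarrow> real \<Rightarrow> real \<Rightarrow> nat \<Rightarrow> (quat \<Rightarrow> quat) \<Rightarrow> 'v \<Rightarrow> 'v option" where
  "Hinf_calc lm rm D T \<omega> \<mu> k f v =
     (let w = S_calc lm rm D T \<omega> \<mu> (\<lambda>s. qmul (psi_fun k s) (f s)) v in
      if w \<in> range (psi_op rm D T k) then Some (inv_into UNIV (psi_op rm D T k) w) else None)"

end

theory Submission
  imports Defs "HOL-Complex_Analysis.Cauchy_Integral_Theorem"
begin

text \<open>Write \<open>k' = k + d\<close> and \<open>A = T (I + T\<^sup>2)\<^sup>-\<^sup>1\<close>, so that \<open>\<psi>\<^sub>k(T)\<close> is the power \<open>k + 1\<close> of the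
  injective operator \<open>A\<close>.  It suffices that \<open>(\<psi>\<^sub>k\<^sub>' f)(T)\<close> is \<open>A\<close> applied \<open>d\<close> times to \<open>(\<psi>\<^sub>k f)(T)\<close>.
  For \<open>g(s) = (s + 1/s) h(s)\<close> a resolvent identity writes \<open>A\<close> applied to the integrand of \<open>g(T)\<close> as the
  integrand of \<open>h(T)\<close> plus bounded operators applied to \<open>h(s) ds\<close> and \<open>h(s) ds / s\<close>, whose
  integrals over the two rays cancel by Cauchy's theorem.  Dividing by \<open>s + 1/s\<close> instead of multiplying
  by the regularizer avoids any discussion of the poles at the imaginary units, which lie
  inside the contour or on it when the angle is at least \<open>\<pi>/2\<close>.\<close>

section \<open>Integration over the half line\<close>

text \<open>Increments of \<open>P\<close> are controlled by those of a convergent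
  \<open>\<Phi>\<close>, so \<open>P\<close> is Cauchy along the filter, and completeness supplies a
  limit that need not be known explicitly.\<close>

lemma tendsto_of_dist_le:
  fixes P :: "'b \<Rightarrow> 'a::banach" and \<Phi> :: "'b \<Rightarrow> 'c::metric_space"
  assumes le: "\<And>x y. x \<in> S \<Longrightarrow> y \<in> S \<Longrightarrow> dist (P x) (P y) \<le> dist (\<Phi> x) (\<Phi> y)"
    and ev: "eventually (\<lambda>x. x \<in> S) F" and lim: "(\<Phi> \<longlongrightarrow> L) F" and F: "F \<noteq> bot"
  shows "\<exists>l. (P \<longlongrightarrow> l) F"
proof -
  have "cauchy_filter (filtermap P F)"
    unfolding cauchy_filter_metric_filtermap
  proof (intro allI impI)
    fix e :: real assume "e > 0"
    then have "eventually (\<lambda>x. x \<in> S \<and> dist (\<Phi> x) L < e / 2) F"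
      using ev tendstoD[OF lim, of "e/2"] by (auto intro: eventually_conj)
    moreover have "dist (P x) (P y) < e"
      if "x \<in> S \<and> dist (\<Phi> x) L < e / 2" "y \<in> S \<and> dist (\<Phi> y) L < e / 2" for x y
    proof -
      have "dist (\<Phi> x) (\<Phi> y) < e"
        using dist_triangle_half_r[of L "\<Phi> x" e "\<Phi> y"] that by (auto simp: dist_commute)
      with le[of x y] that show ?thesis by auto
    qed
    ultimately show "\<exists>Q. eventually Q F \<and> (\<forall>x y. Q x \<and> Q y \<longrightarrow> dist (P x) (P y) < e)"
      by blast
  qed
  then show ?thesis
    using cauchy_filter_complete_converges[of "filtermap P F" UNIV] F complete_UNIV
    by (auto simp: filtermap_bot_iff filterlim_def)
qed

text \<open>Continuing \<open>P\<close> to the left of 0 by the constant \<open>L0\<close> makes it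
  continuous on the whole line, so the theorem on compact intervals applies with 0 as the only
  exceptional point.\<close>

lemma has_integral_half_line_FTC:
  fixes P :: "real \<Rightarrow> 'a::banach"
  assumes der: "\<And>r. r > 0 \<Longrightarrow> (P has_vector_derivative f r) (at r)"
    and l0: "(P \<longlongrightarrow> L0) (at_right 0)" and l1: "(P \<longlongrightarrow> L1) at_top"
  shows "(f has_integral (L1 - L0)) {0<..}"
proof -
  define P' where "P' r = (if r \<le> 0 then L0 else P r)" for r
  define f' where "f' r = (if r \<in> {0<..} then f r else 0)" for r
  have derP: "(P' has_vector_derivative f' r) (at r)" if "r \<noteq> 0" for r
  proof (cases "r > 0")
    case True
    then have "(P has_vector_derivative f' r) (at r)"
      using der by (simp add: f'_def)
    then show ?thesis
      by (rule has_vector_derivative_transform_within_open[of _ _ _ "{0<..}"])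
        (use True in \<open>auto simp: P'_def\<close>)
  next
    case False
    have "((\<lambda>_. L0) has_vector_derivative f' r) (at r)"
      using False by (simp add: f'_def)
    then show ?thesis
      by (rule has_vector_derivative_transform_within_open[of _ _ _ "{..<0}"])
        (use False that in \<open>auto simp: P'_def\<close>)
  qed
  have cont0: "isCont P' 0"
  proof -
    have "(P' \<longlongrightarrow> L0) (at_right 0)"
      using l0 by (rule Lim_transform_eventually)
        (auto simp: eventually_at_filter P'_def)
    moreover have "(P' \<longlongrightarrow> L0) (at_left 0)"
      by (rule Lim_transform_eventually[OF tendsto_const])
        (auto simp: eventually_at_filter P'_def)
    ultimately show ?thesis
      by (simp add: isCont_def filterlim_at_split P'_def)
  qed
  have "isCont P' r" for r
    using cont0 derP[of r] has_vector_derivative_continuous by (cases "r = 0") auto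
  then have contP: "continuous_on {a..b} P'" for a b
    by (simp add: continuous_at_imp_continuous_on)
  have int: "(f' has_integral (P' b - P' a)) {a..b}" if "a \<le> b" for a b
    using fundamental_theorem_of_calculus_strong[of "{0}" a b P' f'] that derP contP by auto
  show ?thesis
    unfolding has_integral_alt'
  proof (intro conjI allI impI)
    fix a b :: real
    show "(\<lambda>x. if x \<in> {0<..} then f x else 0) integrable_on cbox a b"
      using int[of a b] unfolding f'_def by (cases "a \<le> b") auto
  next
    fix e :: real assume "e > 0"
    then have "eventually (\<lambda>b. dist (P b) L1 < e) at_top"
      using l1 by (rule tendstoD[rotated])
    then obtain B where B: "\<And>b. b \<ge> B \<Longrightarrow> dist (P b) L1 < e"
      by (auto simp: eventually_at_top_linorder)
    show "\<exists>B>0. \<forall>a b. ball 0 B \<subseteq> cbox a b \<longrightarrow>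
      norm (integral (cbox a b) (\<lambda>x. if x \<in> {0<..} then f x else 0) - (L1 - L0)) < e"
    proof (intro exI[of _ "max 1 B"] conjI allI impI)
      fix a b :: real assume sub: "ball 0 (max 1 B) \<subseteq> cbox a b"
      \<comment> \<open>The ball is open; its closure also contains the points
        \<open>max 1 B\<close> and \<open>- max 1 B\<close>, whence \<open>b \<ge> B\<close>. The 1
        keeps the radius positive, so that \<open>a < 0 < b\<close>.\<close>
      have "closure (ball 0 (max 1 B)) \<subseteq> {a..b}"
        using sub by (intro closure_minimal) auto
      then have "t \<in> {a..b}" if "\<bar>t\<bar> \<le> max 1 B" for t
        using that by (auto simp: dist_real_def subset_iff)
      from this[of "- max 1 B"] this[of "max 1 B"] have ab: "a < 0" "b > 0" "b \<ge> B" by auto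
      have "integral {a..b} f' = P b - L0"
        using int[of a b] ab by (auto simp: P'_def dest!: integral_unique)
      then show "norm (integral (cbox a b) (\<lambda>x. if x \<in> {0<..} then f x else 0) - (L1 - L0)) < e"
        using B[OF ab(3)] by (simp add: f'_def[abs_def] dist_norm)
    qed auto
  qed
qed

lemma continuous_on_half_line_antiderivative:
  fixes f :: "real \<Rightarrow> 'a::banach"
  assumes cont: "continuous_on {0<..} f"
  obtains P where "\<And>r. r > 0 \<Longrightarrow> (P has_vector_derivative f r) (at r)"
proof
  fix x :: real assume x: "x > 0"
  \<comment> \<open>A primitive based at 1: at least one of the two intervals is empty or
    degenerate, so this is the oriented integral from 1 to \<open>x\<close>. Near a given point it
    differs by a constant from the primitive based at \<open>a\<close>, a number below both that
    point and 1.\<close>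
  define P where "P x = integral {1..x} f - integral {x..1} f" for x
  define a where "a = min (x/2) (1/2)"
  define b where "b = x + 1"
  have ab: "0 < a" "a < x" "a < 1" "x < b" using x by (auto simp: a_def b_def)
  have cab: "continuous_on {a..c} f" for c
    using cont by (rule continuous_on_subset) (use ab in auto)
  have "((\<lambda>u. integral {a..u} f) has_vector_derivative f x) (at x within {a..b})"
    using cab ab by (intro integral_has_vector_derivative) auto
  then have "((\<lambda>u. integral {a..u} f) has_vector_derivative f x) (at x)"
    using at_within_interior[of x "{a..b}"] ab by simp
  then have "((\<lambda>u. integral {a..u} f - integral {a..1} f) has_vector_derivative f x) (at x)"
    by (auto intro!: derivative_eq_intros)
  then show "(P has_vector_derivative f x) (at x)"
  proof (rule has_vector_derivative_transform_within_open[of _ _ _ "{a<..}"])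
    fix y assume y: "y \<in> {a<..}"
    have i: "f integrable_on {a..c}" for c
      using cab by (rule integrable_continuous_real)
    show "integral {a..y} f - integral {a..1} f = P y"
    proof (cases "y \<le> 1")
      case True
      then have "integral {a..1} f = integral {a..y} f + integral {y..1} f"
        using y i by (intro Henstock_Kurzweil_Integration.integral_combine[symmetric]) auto
      then show ?thesis using True by (cases "y = 1") (auto simp: P_def)
    next
      case False
      then have "integral {a..y} f = integral {a..1} f + integral {1..y} f"
        using ab i by (intro Henstock_Kurzweil_Integration.integral_combine[symmetric]) auto
      then show ?thesis using False by (auto simp: P_def)
    qed
  qed (use ab in auto)
qed

text \<open>The bound in \<open>Psi_L\<close> as a function of \<open>norm s\<close>. For
  \<open>r > 0\<close> it equals \<open>1 / (r powr \<alpha> + r powr - \<alpha>)\<close>, hence it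
  is symmetric under inversion of \<open>r\<close>.\<close>

definition decay :: "real \<Rightarrow> real \<Rightarrow> real" where
  "decay \<alpha> r = r powr \<alpha> / (1 + r powr (2 * \<alpha>))"

lemma decay_nonneg: "decay \<alpha> r \<ge> 0"
  by (simp add: decay_def add_nonneg_nonneg)

lemma decay_pos: "r > 0 \<Longrightarrow> decay \<alpha> r > 0"
  by (simp add: decay_def add_pos_nonneg)

lemma decay_tendsto_0:
  assumes "\<alpha> > 0"
  shows "(decay \<alpha> \<longlongrightarrow> 0) (at_right 0)" and "(decay \<alpha> \<longlongrightarrow> 0) at_top"
proof -
  have "((\<lambda>r::real. r powr \<alpha>) \<longlongrightarrow> 0) (at_right 0)" 
    using assms by (intro tendsto_eq_intros) (auto simp: eventually_at_filter)
  moreover have "eventually (\<lambda>r. norm (decay \<alpha> r) \<le> r powr \<alpha>) (at_right 0)"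
    by (rule always_eventually) (auto simp: decay_def divide_le_eq add_pos_nonneg mult_le_cancel_left1)
  ultimately show "(decay \<alpha> \<longlongrightarrow> 0) (at_right 0)"
    by (rule Lim_null_comparison[rotated])
  have "((\<lambda>r::real. r powr - \<alpha>) \<longlongrightarrow> 0) at_top"
    using assms by (intro tendsto_neg_powr filterlim_ident) auto
  moreover have "eventually (\<lambda>r. norm (decay \<alpha> r) \<le> r powr - \<alpha>) at_top"
    using eventually_gt_at_top[of 0]
  proof eventually_elim
    case (elim r)
    have "r powr (2 * \<alpha>) = r powr \<alpha> * r powr \<alpha>" by (simp flip: powr_add)
    with elim show ?case
      by (simp add: decay_def powr_minus field_simps add_pos_nonneg)
  qed
  ultimately show "(decay \<alpha> \<longlongrightarrow> 0) at_top"
    by (rule Lim_null_comparison[rotated])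
qed

lemma arctan_powr_has_derivative:
  assumes "r > 0" "\<alpha> > 0"
  shows "((\<lambda>r. C / \<alpha> * arctan (r powr \<alpha>)) has_real_derivative C * decay \<alpha> r / r) (at r)"
proof -
  have "((\<lambda>r. C / \<alpha> * arctan (r powr \<alpha>)) has_real_derivative
      C / \<alpha> * (inverse (1 + (r powr \<alpha>)\<^sup>2) * (\<alpha> * r powr (\<alpha> - 1)))) (at r)"
    using assms by (auto intro!: derivative_eq_intros)
  moreover have "(r powr \<alpha>)\<^sup>2 = r powr (2 * \<alpha>)"
    by (simp add: power2_eq_square flip: powr_add)
  moreover have "C / \<alpha> * (x * (\<alpha> * y)) = C * (x * y)" for x y
    using assms by simp
  ultimately show ?thesis
    using assms by (elim DERIV_cong) (simp only:, simp add: decay_def powr_diff divide_inverse mult_ac)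
qed

text \<open>The bound on \<open>f\<close> is, up to a factor, the derivative of \<open>arctan (r powr \<alpha>)\<close>.\<close>

lemma integrable_half_line_of_decay:
  fixes f :: "real \<Rightarrow> 'a::banach"
  assumes cont: "continuous_on {0<..} f" and \<alpha>: "\<alpha> > 0"
    and bnd: "\<And>r. r > 0 \<Longrightarrow> norm (f r) \<le> C * decay \<alpha> r / r"
  shows "f integrable_on {0<..}"
proof -
  obtain P where P: "\<And>r. r > 0 \<Longrightarrow> (P has_vector_derivative f r) (at r)"
    using continuous_on_half_line_antiderivative[OF cont] by blast
  define \<Phi> where "\<Phi> r = C / \<alpha> * arctan (r powr \<alpha>)" for r
  have \<Phi>: "(\<Phi> has_vector_derivative C * decay \<alpha> r / r) (at r)" if "r > 0" for r
    using arctan_powr_has_derivative[OF that \<alpha>, of C]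
    by (simp add: \<Phi>_def[abs_def] has_real_derivative_iff_has_vector_derivative)
  \<comment> \<open>The norm of \<open>f\<close> is at most the derivative of \<open>\<Phi>\<close>,
    so the mean value inequality compares increments. The finite limits of \<open>\<Phi>\<close> at
    0 and infinity then force limits of \<open>P\<close>.\<close>
  have lt: "dist (P x) (P y) \<le> dist (\<Phi> x) (\<Phi> y)" if "0 < x" "x < y" for x y
  proof -
    have "norm (P y - P x) \<le> \<Phi> y - \<Phi> x"
    proof (rule differentiable_bound_general[where f' = f and \<phi>' = "\<lambda>r. C * decay \<alpha> r / r"])
      show "continuous_on {x..y} P"
        using that P by (intro continuous_at_imp_continuous_on ballI has_vector_derivative_continuous[OF P]) auto
      show "continuous_on {x..y} \<Phi>"
        using that \<Phi> by (intro continuous_at_imp_continuous_on ballI has_vector_derivative_continuous[OF \<Phi>]) auto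
    qed (use that P \<Phi> bnd in auto)
    then show ?thesis by (simp add: dist_norm norm_minus_commute)
  qed
  have le: "dist (P x) (P y) \<le> dist (\<Phi> x) (\<Phi> y)" if "x \<in> {0<..}" "y \<in> {0<..}" for x y
    using lt[of x y] lt[of y x] that by (cases x y rule: linorder_cases) (auto simp: dist_commute)
  have "((\<lambda>r::real. r powr \<alpha>) \<longlongrightarrow> 0) (at_right 0)" 
    using \<alpha> by (intro tendsto_eq_intros) (auto simp: eventually_at_filter)
  then have "(\<Phi> \<longlongrightarrow> C / \<alpha> * arctan 0) (at_right 0)"
    unfolding \<Phi>_def by (intro tendsto_intros)
  then obtain L0 where "(P \<longlongrightarrow> L0) (at_right 0)"
    using tendsto_of_dist_le[where P = P and \<Phi> = \<Phi> and S = "{0<..}" and F = "at_right 0", OF le]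
    by (auto simp: eventually_at_filter)
  moreover have "filterlim (\<lambda>r::real. r powr \<alpha>) at_top at_top"
  proof (rule filterlim_cong[THEN iffD2, OF refl refl])
    show "eventually (\<lambda>r::real. r powr \<alpha> = exp (\<alpha> * ln r)) at_top"
      using eventually_gt_at_top[of 0] by eventually_elim (simp add: powr_def)
    show "filterlim (\<lambda>r::real. exp (\<alpha> * ln r)) at_top at_top"
      by (intro filterlim_compose[OF exp_at_top] filterlim_tendsto_pos_mult_at_top[OF tendsto_const \<alpha>] ln_at_top)
  qed
  then have "((\<lambda>r. arctan (r powr \<alpha>)) \<longlongrightarrow> pi / 2) at_top"
    using filterlim_compose tendsto_arctan_at_top by blast
  then have "(\<Phi> \<longlongrightarrow> C / \<alpha> * (pi / 2)) at_top"
    unfolding \<Phi>_def by (intro tendsto_intros)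
  then obtain L1 where "(P \<longlongrightarrow> L1) at_top"
    using tendsto_of_dist_le[where P = P and \<Phi> = \<Phi> and S = "{0<..}" and F = at_top, OF le] by (auto simp: eventually_gt_at_top)
  ultimately show ?thesis
    using has_integral_half_line_FTC[OF P] by blast
qed

section \<open>Cauchy's theorem in a strip\<close>

definition strip :: "real \<Rightarrow> complex set" where
  "strip a = {w. \<bar>Im w\<bar> < a}"

lemma open_strip: "open (strip a)"
  unfolding strip_def by (intro open_Collect_less continuous_intros)

lemma strip_eq: "strip a = {w. Im w < a} \<inter> {w. Im w > - a}"
  by (auto simp: strip_def)

lemma convex_strip: "convex (strip a)"
  unfolding strip_eq by (intro convex_Int convex_halfspace_Im_lt convex_halfspace_Im_gt)

lemma Complex_ln_has_vector_derivative:
  assumes "r > 0"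
  shows "((\<lambda>r. Complex (ln r) \<theta>) has_vector_derivative of_real (1 / r)) (at r)"
proof -
  have eq: "(\<lambda>r. Complex (ln r) \<theta>) = (\<lambda>r. of_real (ln r) + \<i> * of_real \<theta>)"
    by (auto simp: complex_eq_iff)
  show ?thesis
    unfolding eq using assms
    by (auto intro!: derivative_eq_intros has_vector_derivative_of_real simp: divide_inverse)
qed

lemma continuous_on_Complex_ln: "continuous_on {0<..} (\<lambda>r. Complex (ln r) \<theta>)"
  by (rule continuous_at_imp_continuous_on)
    (auto intro: has_vector_derivative_continuous[OF Complex_ln_has_vector_derivative])

text \<open>Cauchy's theorem for a contour through 0 and infinity, in the variable
  \<open>w = ln s\<close>: the two rays become horizontal lines, \<open>ds / s\<close> becomes
  \<open>dw\<close>, and the vertical sides of the rectangles vanish in the limit by the decay of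
  \<open>K\<close>.\<close>

lemma strip_boundary_integrals_agree:
  fixes K :: "complex \<Rightarrow> complex"
  assumes holo: "K holomorphic_on strip \<mu>" and \<theta>: "0 < \<theta>" "\<theta> < \<mu>" and \<alpha>: "\<alpha> > 0"
    and bnd: "\<And>w. \<bar>Im w\<bar> \<le> \<theta> \<Longrightarrow> norm (K w) \<le> C * decay \<alpha> (exp (Re w))"
  shows "\<exists>J. \<forall>\<phi>\<in>{\<theta>, - \<theta>}. ((\<lambda>r. K (Complex (ln r) \<phi>) / of_real r) has_integral J) {0<..}"
proof -
  define k where "k \<phi> r = K (Complex (ln r) \<phi>) / of_real r" for \<phi> r
  have int: "k \<phi> integrable_on {0<..}" if "\<bar>\<phi>\<bar> = \<theta>" for \<phi>
  proof (rule integrable_half_line_of_decay[OF _ \<alpha>])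
    have "(\<lambda>r. Complex (ln r) \<phi>) ` {0<..} \<subseteq> strip \<mu>"
      using that \<theta> by (auto simp: strip_def)
    then show "continuous_on {0<..} (k \<phi>)"
      unfolding k_def
      by (intro continuous_intros continuous_on_compose2[OF holomorphic_on_imp_continuous_on[OF holo]]
          continuous_on_Complex_ln) auto
    show "norm (k \<phi> r) \<le> C * decay \<alpha> r / r" if "r > 0" for r
      using bnd[of "Complex (ln r) \<phi>"] that \<open>\<bar>\<phi>\<bar> = \<theta>\<close>
      by (simp add: k_def norm_divide divide_right_mono)
  qed
  obtain F where F0: "\<And>w. w \<in> strip \<mu> \<Longrightarrow> (F has_field_derivative K w) (at w within strip \<mu>)"
    using holomorphic_convex_primitive'[OF convex_strip open_strip holo] by blast
  have F: "(F has_field_derivative K w) (at w)" if "w \<in> strip \<mu>" for w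
    using F0[OF that] unfolding at_within_open[OF that open_strip] .
  \<comment> \<open>The integral of \<open>K\<close> over the vertical segment at real part
    \<open>ln r\<close>. Its derivative is the difference of the two integrands, and its norm is at
    most the bound on \<open>K\<close> times the length \<open>2 * \<theta>\<close>.\<close>
  define P where "P r = F (Complex (ln r) \<theta>) - F (Complex (ln r) (- \<theta>))" for r
  have Fr: "((\<lambda>r. F (Complex (ln r) \<phi>)) has_vector_derivative k \<phi> r) (at r)"
    if "r > 0" "\<bar>\<phi>\<bar> = \<theta>" for r \<phi>
  proof -
    have "Complex (ln r) \<phi> \<in> strip \<mu>"
      using that \<theta> by (auto simp: strip_def)
    from field_vector_diff_chain_at[OF Complex_ln_has_vector_derivative[OF that(1)] F[OF this]]
    show ?thesis
      by (simp add: o_def k_def field_simps)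
  qed
  have P: "(P has_vector_derivative k \<theta> r - k (- \<theta>) r) (at r)" if "r > 0" for r
    unfolding P_def using Fr[OF that] \<theta> by (intro has_vector_derivative_diff) auto
  have Pb: "norm (P r) \<le> C * decay \<alpha> r * (2 * \<theta>)" if "r > 0" for r
  proof -
    \<comment> \<open>The vertical segment, written as an intersection of half planes to make its
      convexity evident.\<close>
    let ?S = "{w. Re w \<le> ln r} \<inter> {w. Re w \<ge> ln r} \<inter> {w. Im w \<le> \<theta>} \<inter> {w. Im w \<ge> - \<theta>}"
    have "norm (P r) \<le> C * decay \<alpha> r * norm (Complex (ln r) \<theta> - Complex (ln r) (- \<theta>))"
      unfolding P_def
    proof (rule field_differentiable_bound[where S = ?S and f' = K])
      show "convex ?S"
        by (intro convex_Int convex_halfspace_Im_le convex_halfspace_Im_ge convex_halfspace_Re_le convex_halfspace_Re_ge)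
      show "(F has_field_derivative K w) (at w within ?S)" if "w \<in> ?S" for w
        using that \<theta> by (intro has_field_derivative_at_within[OF F]) (auto simp: strip_def)
      show "norm (K w) \<le> C * decay \<alpha> r" if "w \<in> ?S" for w
        using bnd[of w] that \<open>r > 0\<close> by auto
    qed (use \<theta> in auto)
    also have "norm (Complex (ln r) \<theta> - Complex (ln r) (- \<theta>)) = 2 * \<theta>"
      using \<theta> by (simp add: complex_diff complex_norm real_sqrt_mult)
    finally show ?thesis .
  qed
  have lim: "((\<lambda>r. C * decay \<alpha> r * (2 * \<theta>)) \<longlongrightarrow> C * 0 * (2 * \<theta>)) F"
    if "F = at_right 0 \<or> F = at_top" for F
    using decay_tendsto_0[OF \<alpha>] that by (intro tendsto_intros) auto
  have "(P \<longlongrightarrow> 0) (at_right 0)"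
    using lim[of "at_right 0"] Pb
    by (intro Lim_null_comparison[of P "\<lambda>r. C * decay \<alpha> r * (2 * \<theta>)"]) (auto simp: eventually_at_filter)
  moreover have "(P \<longlongrightarrow> 0) at_top"
    using lim[of at_top] Pb
    by (intro Lim_null_comparison[of P "\<lambda>r. C * decay \<alpha> r * (2 * \<theta>)"])
      (auto intro: eventually_mono[OF eventually_gt_at_top])
  ultimately have "((\<lambda>r. k \<theta> r - k (- \<theta>) r) has_integral 0 - 0) {0<..}"
    using has_integral_half_line_FTC[OF P] by blast
  moreover obtain J where J: "(k (- \<theta>) has_integral J) {0<..}"
    using int[of "- \<theta>"] \<theta> by (auto simp: integrable_on_def)
  ultimately have "((\<lambda>r. (k \<theta> r - k (- \<theta>) r) + k (- \<theta>) r) has_integral (0 - 0) + J) {0<..}"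
    by (rule has_integral_add)
  with J show ?thesis
    by (auto simp: k_def[abs_def])
qed

section \<open>Resolvents of right linear operators\<close>

lemma qmul_complex: "qmul (a, 0) q = (a * fst q, a * snd q)"
  by (simp add: qmul_def)

lemma norm_qmul_complex: "norm (qmul (a, 0) q) = norm a * norm q"
  by (simp add: qmul_complex norm_prod_def norm_mult power_mult_distrib flip: distrib_left)
    (simp add: real_sqrt_mult)

text \<open>The second component of \<open>qmul i i = - qone\<close> factors: either
  \<open>i\<close> lies in the complex slice, where it is \<open>qi\<close> or \<open>- qi\<close>,
  or its complex part is purely imaginary.\<close>

lemma qRe_qS: "i \<in> qS \<Longrightarrow> qRe i = 0"
proof -
  assume "i \<in> qS"
  then have eq: "fst i * fst i - snd i * cnj (snd i) = -1" "fst i * snd i + snd i * cnj (fst i) = 0"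
    by (auto simp: qS_def qmul_def qone_def qof_real_def prod_eq_iff)
  from eq(2) have "snd i * (fst i + cnj (fst i)) = 0"
    by (simp add: algebra_simps)
  then consider "snd i = 0" | "fst i + cnj (fst i) = 0" by auto
  then show ?thesis
  proof cases
    case 1
    with eq(1) have "(fst i)\<^sup>2 = \<i>\<^sup>2" by (simp add: power2_eq_square)
    then have "fst i = \<i> \<or> fst i = - \<i>" by (simp only: power2_eq_iff)
    then show ?thesis by (auto simp: qRe_def)
  next
    case 2
    then show ?thesis by (simp add: complex_add_cnj qRe_def)
  qed
qed

lemma qi_in_qS: "qi \<in> qS" "- qi \<in> qS"
  by (auto simp: qS_def qi_def qmul_def qone_def qof_real_def)

text \<open>Uniqueness rests on real parts: units in \<open>qS\<close> have real part 0, so every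
  angle in question has the cosine of \<open>\<bar>Im w\<bar>\<close>, and cosine is injective
  between 0 and \<open>pi\<close>. The unit itself never has to be identified.\<close>

lemma qarg_exp:
  assumes "\<bar>Im w\<bar> \<le> pi"
  shows "qarg (exp w, 0) = \<bar>Im w\<bar>"
  unfolding qarg_def
proof (rule the_equality)
  have n: "norm (exp w, 0::complex) = exp (Re w)" by (simp add: norm_Pair)
  define i where "i = (if Im w \<ge> 0 then qi else - qi)"
  have "(exp w, 0) = norm (exp w, 0::complex) *\<^sub>R qexp \<bar>Im w\<bar> i"
    unfolding n by (auto simp: i_def qexp_def qof_real_def qi_def complex_eq_iff Re_exp Im_exp)
  moreover have "i \<in> qS" using qi_in_qS by (simp add: i_def)
  ultimately have ex: "\<exists>i\<in>qS. (exp w, 0) = norm (exp w, 0::complex) *\<^sub>R qexp \<bar>Im w\<bar> i"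
    by (rule bexI)
  show "0 \<le> \<bar>Im w\<bar> \<and> \<bar>Im w\<bar> \<le> pi \<and> (\<exists>i\<in>qS. (exp w, 0) = norm (exp w, 0::complex) *\<^sub>R qexp \<bar>Im w\<bar> i)"
    by (intro conjI abs_ge_zero assms ex)
  fix \<phi> assume *: "0 \<le> \<phi> \<and> \<phi> \<le> pi \<and> (\<exists>i\<in>qS. (exp w, 0) = norm (exp w, 0::complex) *\<^sub>R qexp \<phi> i)"
  then obtain j where j: "j \<in> qS" "(exp w, 0) = exp (Re w) *\<^sub>R qexp \<phi> j" unfolding n by blast
  have "qRe (exp w, 0) = exp (Re w) * cos \<phi>"
    by (subst j(2)) (use qRe_qS[OF j(1)] in \<open>simp add: qRe_def qexp_def qof_real_def\<close>)
  then have "cos \<phi> = cos \<bar>Im w\<bar>" by (simp add: qRe_def Re_exp)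
  then show "\<phi> = \<bar>Im w\<bar>"
    using *[THEN conjunct1] *[THEN conjunct2, THEN conjunct1] assms
    by (simp add: cos_inj_pi)
qed

lemma exp_in_sector0_iff: "\<bar>Im w\<bar> \<le> pi \<Longrightarrow> (exp w, 0) \<in> sector0 \<mu> \<longleftrightarrow> \<bar>Im w\<bar> < \<mu>"
  and exp_in_sector_iff: "\<bar>Im w\<bar> \<le> pi \<Longrightarrow> (exp w, 0) \<in> sector \<mu> \<longleftrightarrow> \<bar>Im w\<bar> \<le> \<mu>"
  by (simp_all add: sector0_def sector_def qarg_exp zero_prod_def)

section \<open>Two-sided modules over the quaternions\<close>

locale quat_bimodule =
  fixes lm :: "quat \<Rightarrow> 'v::banach \<Rightarrow> 'v" and rm :: "'v \<Rightarrow> quat \<Rightarrow> 'v"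
  assumes bimodule: "two_sided_qbanach lm rm"
begin

abbreviation cl :: "complex \<Rightarrow> 'v \<Rightarrow> 'v" where "cl c \<equiv> lm (c, 0)"

lemma lm_add_left: "lm (p + q) v = lm p v + lm q v"
  and lm_add_right: "lm q (u + v) = lm q u + lm q v"
  and lm_qmul: "lm (qmul p q) v = lm p (lm q v)"
  and lm_qof_real: "lm (qof_real r) v = r *\<^sub>R v"
  and rm_qof_real: "rm v (qof_real r) = r *\<^sub>R v"
  and norm_lm: "norm (lm q v) = norm q * norm v"
  using bimodule unfolding two_sided_qbanach_def by (simp_all del: split_paired_All)

lemma cl_mult: "cl (a * b) v = cl a (cl b v)"
  using lm_qmul[of "(a, 0)" "(b, 0)" v] by (simp add: qmul_complex)

lemma cl_of_real: "cl (of_real r) v = r *\<^sub>R v"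
  using lm_qof_real by (simp add: qof_real_def)

lemma cl_1: "cl 1 v = v"
  using cl_of_real[of 1 v] by simp

lemma cl_commute: "cl a (cl b v) = cl b (cl a v)"
  by (simp flip: cl_mult add: mult.commute)

lemma bounded_bilinear_lm: "bounded_bilinear lm"
proof
  have q: "r *\<^sub>R q = qmul (qof_real r) q" for r q
    by (simp add: qof_real_def qmul_complex prod_eq_iff scaleR_conv_of_real)
  show l: "lm (r *\<^sub>R q) v = r *\<^sub>R lm q v" for r q v
    by (simp add: q lm_qmul lm_qof_real)
  have "qmul q (qof_real r) = r *\<^sub>R q" for r q
    by (simp add: qof_real_def qmul_def prod_eq_iff scaleR_conv_of_real mult.commute)
  then show "lm q (r *\<^sub>R v) = r *\<^sub>R lm q v" for r q v
    using lm_qmul[of q "qof_real r" v] by (simp add: l lm_qof_real)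
  show "\<exists>K. \<forall>a b. norm (lm a b) \<le> norm a * norm b * K"
    by (rule exI[of _ 1]) (simp add: norm_lm)
qed (simp_all add: lm_add_left lm_add_right)

sublocale lm: bounded_bilinear lm
  by (rule bounded_bilinear_lm)

lemma cl_add: "cl (a + b) v = cl a v + cl b v"
  using lm_add_left[of "(a, 0)" "(b, 0)"] by simp

lemma cl_diff: "cl (a - b) v = cl a v - cl b v"
  using lm.diff_left[of "(a, 0)" "(b, 0)"] by simp

lemma continuous_on_cl:
  assumes "continuous_on S c" "continuous_on S x"
  shows "continuous_on S (\<lambda>r. cl (c r) (x r))"
  using assms by (intro lm.continuous_on continuous_intros)

end

section \<open>The operators \<open>Q s\<close> and the S-resolvent equations\<close>

locale right_linear_operator = quat_bimodule lm rm
  for lm :: "quat \<Rightarrow> 'v::banach \<Rightarrow> 'v" and rm +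
  fixes D :: "'v set" and T :: "'v \<Rightarrow> 'v"
  assumes right_linear: "right_linear_op rm D T"
begin

lemma D_scaleR: "v \<in> D \<Longrightarrow> r *\<^sub>R v \<in> D"
  and T_scaleR: "v \<in> D \<Longrightarrow> T (r *\<^sub>R v) = r *\<^sub>R T v"
  using right_linear unfolding right_linear_op_def right_subspace_def by (metis rm_qof_real)+

lemma D_0: "0 \<in> D"
  and D_add: "u \<in> D \<Longrightarrow> v \<in> D \<Longrightarrow> u + v \<in> D"
  and T_add: "u \<in> D \<Longrightarrow> v \<in> D \<Longrightarrow> T (u + v) = T u + T v"
  using right_linear unfolding right_linear_op_def right_subspace_def by auto

lemma D_diff: "u \<in> D \<Longrightarrow> v \<in> D \<Longrightarrow> u - v \<in> D"
  and T_diff: "u \<in> D \<Longrightarrow> v \<in> D \<Longrightarrow> T (u - v) = T u - T v"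
  using D_add[of u "(-1) *\<^sub>R v"] T_add[of u "(-1) *\<^sub>R v"] D_scaleR[of v "-1"] T_scaleR[of v "-1"]
  by auto

lemma T_0: "T 0 = 0"
  using T_scaleR[OF D_0, of 0] by simp

lemmas D_intros = D_0 D_add D_diff D_scaleR

abbreviation Q :: "quat \<Rightarrow> 'v \<Rightarrow> 'v" where "Q \<equiv> Qs rm D T"
abbreviation \<rho> :: "quat set" where "\<rho> \<equiv> S_resolvent_set rm D T"

text \<open>Two-sided inverses are unique, so the definite description in \<open>Qs\<close> is
  meaningful.\<close>

lemma is_Qinv_Q: "s \<in> \<rho> \<Longrightarrow> is_Qinv rm D T s (Q s)"
proof -
  assume "s \<in> \<rho>"
  then obtain R where R: "is_Qinv rm D T s R" by (auto simp: S_resolvent_set_def)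
  have "R' = R" if "is_Qinv rm D T s R'" for R'
  proof
    fix v
    show "R' v = R v"
      using R that unfolding is_Qinv_def by metis
  qed
  with R show ?thesis
    unfolding Qs_def by (rule theI)
qed

context
  fixes s assumes s: "s \<in> \<rho>"
begin

lemma bounded_linear_Q: "bounded_linear (Q s)"
  and Q_in_D: "Q s v \<in> D"
  and TQ_in_D: "T (Q s v) \<in> D"
  and Q_inverse: "u \<in> D \<Longrightarrow> T u \<in> D \<Longrightarrow> Q s (Qop T s u) = u"
  and Qop_Q: "Qop T s (Q s v) = v"
  using is_Qinv_Q[OF s] by (auto simp: is_Qinv_def bounded_op_def dom2_def)

lemmas Q_add = bounded_linear_Q[THEN bounded_linear.linear, THEN linear_add]
  and Q_diff = bounded_linear_Q[THEN bounded_linear.linear, THEN linear_diff]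
  and Q_scaleR = bounded_linear_Q[THEN bounded_linear.linear, THEN linear_scale]

lemma TTQ: "T (T (Q s v)) = v + (2 * qRe s) *\<^sub>R T (Q s v) - (norm s)\<^sup>2 *\<^sub>R Q s v"
  using Qop_Q[of v] by (simp add: Qop_def algebra_simps)

text \<open>For \<open>v\<close> in \<open>D\<close>, \<open>TTQ\<close> puts
  \<open>T (Q s v)\<close> into the domain of the square of \<open>T\<close>. There the quadratic
  polynomial commutes with \<open>T\<close>, and its inverse can be applied.\<close>

lemma Q_T: "v \<in> D \<Longrightarrow> Q s (T v) = T (Q s v)"
proof -
  assume v: "v \<in> D"
  have TT: "T (T (Q s v)) \<in> D"
    unfolding TTQ using v by (intro D_intros Q_in_D TQ_in_D)
  have "Qop T s (T (Q s v)) = T (Qop T s (Q s v))"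
    using TT by (simp add: Qop_def T_add T_diff T_scaleR D_intros Q_in_D TQ_in_D)
  then show ?thesis
    using Q_inverse[OF TQ_in_D TT] by (simp add: Qop_Q)
qed

lemma SL_in_D: "SL lm rm D T s x \<in> D"
  by (simp add: SL_def D_diff Q_in_D TQ_in_D)

lemma linear_TQ: "linear (\<lambda>v. T (Q s v))"
  by (rule linearI) (simp_all add: Q_add Q_scaleR T_add T_scaleR Q_in_D)

lemmas TQ_add = linear_TQ[THEN linear_add]
  and TQ_diff = linear_TQ[THEN linear_diff]
  and TQ_scaleR = linear_TQ[THEN linear_scale]

lemma SL_add: "SL lm rm D T s (x + y) = SL lm rm D T s x + SL lm rm D T s y"
  by (simp add: SL_def lm_add_right Q_add T_add Q_in_D)

end

lemma Q_conj: "Q (cnj z, 0) = Q (z, 0)"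
proof -
  have "Qop T (cnj z, 0) = Qop T (z, 0)"
    by (auto simp: Qop_def qRe_def norm_Pair)
  then show ?thesis by (simp add: Qs_def is_Qinv_def)
qed

text \<open>Comparing the two quadratic polynomials on \<open>Q p v\<close> cancels the square of
  \<open>T\<close> and leaves real coefficients. The identity yields continuity along a ray and
  carries boundedness from one point to another.\<close>

lemma Q_resolvent_identity:
  assumes "s \<in> \<rho>" "p \<in> \<rho>"
  shows "Q s v - Q p v = Q s ((2 * (qRe s - qRe p)) *\<^sub>R T (Q p v) + ((norm p)\<^sup>2 - (norm s)\<^sup>2) *\<^sub>R Q p v)"
proof -
  have "v - Qop T s (Q p v) = (2 * (qRe s - qRe p)) *\<^sub>R T (Q p v) + ((norm p)\<^sup>2 - (norm s)\<^sup>2) *\<^sub>R Q p v"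
    by (simp add: Qop_def TTQ[OF assms(2)] algebra_simps)
  then show ?thesis
    using Q_inverse[OF assms(1) Q_in_D[OF assms(2)] TQ_in_D[OF assms(2)], of v]
    by (metis Q_diff[OF assms(1)])
qed

text \<open>Applying \<open>T\<close> to the resolvent identity produces
  \<open>T (T (Q p (Q s v)))\<close>, which \<open>TTQ\<close> reduces to bounded operators. This
  carries boundedness from a ray, where the type condition gives it, to \<open>qi\<close>, which may
  lie inside the sector.\<close>

lemma bounded_linear_TQ_of_bounded:
  assumes s: "s \<in> \<rho>" and p: "p \<in> \<rho>" and bp: "bounded_linear (\<lambda>v. T (Q p v))"
  shows "bounded_linear (\<lambda>v. T (Q s v))"
proof -
  let ?W = "\<lambda>v. T (Q p v)"
  have "T (Q s v) = ?W v + ((2 * (qRe s - qRe p)) *\<^sub>R (Q s v + (2 * qRe p) *\<^sub>R ?W (Q s v) - (norm p)\<^sup>2 *\<^sub>R Q p (Q s v))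
      + ((norm p)\<^sup>2 - (norm s)\<^sup>2) *\<^sub>R ?W (Q s v))" for v
  proof -
    have "Q p v = Q s v + Q p ((2 * (qRe p - qRe s)) *\<^sub>R T (Q s v) + ((norm s)\<^sup>2 - (norm p)\<^sup>2) *\<^sub>R Q s v)"
      using Q_resolvent_identity[OF p s, of v] by (simp add: algebra_simps)
    then have "T (Q s v) = ?W v - T (Q p ((2 * (qRe p - qRe s)) *\<^sub>R T (Q s v) + ((norm s)\<^sup>2 - (norm p)\<^sup>2) *\<^sub>R Q s v))"
      by (simp add: T_add Q_in_D[OF s] Q_in_D[OF p])
    also have "\<dots> = ?W v - ((2 * (qRe p - qRe s)) *\<^sub>R T (T (Q p (Q s v))) + ((norm s)\<^sup>2 - (norm p)\<^sup>2) *\<^sub>R ?W (Q s v))"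
      by (simp add: TQ_add[OF p] TQ_scaleR[OF p] Q_T[OF p Q_in_D[OF s]])
    also have "T (T (Q p (Q s v))) = Q s v + (2 * qRe p) *\<^sub>R ?W (Q s v) - (norm p)\<^sup>2 *\<^sub>R Q p (Q s v)"
      by (rule TTQ[OF p])
    finally show ?thesis by (simp add: algebra_simps)
  qed
  moreover have "bounded_linear (\<lambda>v. ?W v + ((2 * (qRe s - qRe p)) *\<^sub>R (Q s v + (2 * qRe p) *\<^sub>R ?W (Q s v) - (norm p)\<^sup>2 *\<^sub>R Q p (Q s v))
      + ((norm p)\<^sup>2 - (norm s)\<^sup>2) *\<^sub>R ?W (Q s v)))"
    using bp bounded_linear_compose[OF bp bounded_linear_Q[OF s]] bounded_linear_Q[OF s]
      bounded_linear_compose[OF bounded_linear_Q[OF p] bounded_linear_Q[OF s]]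
    by (intro bounded_linear_add bounded_linear_sub bounded_linear_const_scaleR)
  ultimately show ?thesis by presburger
qed

text \<open>Besides \<open>TTQ\<close> only the trace \<open>z + cnj z\<close> and the product
  \<open>cnj z * z\<close> enter; both are real and hence pass through \<open>Q\<close> and
  \<open>T\<close>.\<close>

lemma SL_left_resolvent_equation:
  assumes s: "(z, 0) \<in> \<rho>"
  shows "SL lm rm D T (z, 0) (cl z x) = x + T (SL lm rm D T (z, 0) x)"
proof -
  let ?Q = "Q (z, 0)"
  have n: "cl (cnj z) (cl z x) = (norm z)\<^sup>2 *\<^sub>R x"
    using cl_of_real[of "(norm z)\<^sup>2" x] by (simp flip: cl_mult complex_norm_square add: mult.commute)
  have r: "cl (cnj z) x + cl z x = (2 * Re z) *\<^sub>R x"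
    using cl_of_real[of "2 * Re z" x] by (simp flip: cl_add add: complex_add_cnj add.commute)
  have "T (?Q (cl (cnj z) x)) + T (?Q (cl z x)) = (2 * Re z) *\<^sub>R T (?Q x)"
    by (simp flip: TQ_add[OF s] TQ_scaleR[OF s] r)
  moreover have "?Q (cl (cnj z) (cl z x)) = (norm z)\<^sup>2 *\<^sub>R ?Q x"
    by (simp add: n Q_scaleR[OF s])
  ultimately show ?thesis
    using TTQ[OF s, of x]
    by (simp add: SL_def qcnj_def T_diff Q_in_D[OF s] TQ_in_D[OF s] qRe_def norm_Pair algebra_simps)
qed

text \<open>For a scalar \<open>t\<close> in place of \<open>T\<close> this is the partial fraction identity
  \<open>t (1 + s\<^sup>2) / ((1 + t\<^sup>2) (s - t)) = s / (s - t) + (t s - 1) / (1 + t\<^sup>2)\<close>.\<close>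

lemma regularizer_SL:
  assumes s: "(z, 0) \<in> \<rho>" and i: "qi \<in> \<rho>"
  defines "y \<equiv> SL lm rm D T (z, 0)"
  shows "T (Q qi (y (cl (1 + z\<^sup>2) x))) = y (cl z x) + T (Q qi (cl z x)) - Q qi x"
proof -
  let ?B = "Q qi" and ?A = "\<lambda>v. T (Q qi v)"
  have res: "y (cl z x) = x + T (y x)" for x
    unfolding y_def by (rule SL_left_resolvent_equation[OF s])
  have yD: "y x \<in> D" for x
    unfolding y_def by (rule SL_in_D[OF s])
  have TA: "T (?A u) = u - ?B u" for u
    using TTQ[OF i, of u] by (simp add: qi_def qRe_def norm_Pair)
  have AT: "?A (T u) = u - ?B u" if "u \<in> D" for u
    using that by (simp add: Q_T[OF i] TA)
  have BT: "?B (T u) = ?A u" if "u \<in> D" for u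
    using that by (simp add: Q_T[OF i])
  have Ay: "?A (y x) = ?B (y (cl z x)) - ?B x" for x
    by (simp add: res Q_add[OF i] BT yD)
  have z2: "cl (1 + z\<^sup>2) x = x + cl z (cl z x)" for x
    by (simp add: cl_add cl_mult cl_1 power2_eq_square)
  \<comment> \<open>Each factor \<open>z\<close> is exchanged for \<open>T\<close> by the resolvent
    equation, up to resolvent-free terms. The square of \<open>T\<close> under \<open>?B\<close>
    leaves \<open>- ?B (y x)\<close>, which cancels the contribution of the summand 1 in
    \<open>1 + z^2\<close>.\<close>
  have By: "?B (y (cl (1 + z\<^sup>2) x)) = y x + ?B (cl z x) + ?A x" for x
  proof -
    have "?B (y (cl z (cl z x))) = ?B (cl z x) + ?A (y (cl z x))"
      using Ay[of "cl z x"] by (simp add: algebra_simps)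
    also have "?A (y (cl z x)) = ?A x + (y x - ?B (y x))"
      by (simp add: res[of x] TQ_add[OF i] AT yD)
    finally show ?thesis
      by (simp add: z2 y_def SL_add[OF s] Q_add[OF i])
  qed
  have "?A (y (cl (1 + z\<^sup>2) x)) = ?B (y (cl (1 + z\<^sup>2) (cl z x))) - ?B (cl (1 + z\<^sup>2) x)"
    by (simp add: Ay cl_commute)
  also have "\<dots> = y (cl z x) + ?A (cl z x) - ?B x"
    by (simp add: By) (simp add: z2 Q_add[OF i])
  finally show ?thesis .
qed

end

section \<open>Operators of type \<open>\<omega>\<close>\<close>

locale type_omega_operator = right_linear_operator lm rm D T
  for lm :: "quat \<Rightarrow> 'v::banach \<Rightarrow> 'v" and rm D T +
  fixes \<omega> \<mu> :: real
  assumes \<omega>_nonneg: "0 \<le> \<omega>" and \<omega>_less: "\<omega> < \<mu>" and \<mu>_le: "\<mu> \<le> pi"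
    and Omega: "op_in_Omega lm rm D T \<omega>" and units: "qS \<subseteq> \<rho>"
begin

definition \<theta> :: real where "\<theta> = (\<omega> + \<mu>) / 2"

lemma \<theta>: "\<omega> < \<theta>" "\<theta> < \<mu>" "0 < \<theta>" "\<theta> < pi"
  using \<omega>_nonneg \<omega>_less \<mu>_le by (auto simp: \<theta>_def)

lemma type_omega: "op_of_type lm rm D T \<omega>"
  using Omega by (simp add: op_in_Omega_def)

lemma ray_in_resolvent_set:
  assumes "\<bar>Im w\<bar> = \<theta>"
  shows "(exp w, 0) \<in> \<rho>"
proof -
  have "(exp w, 0) \<notin> sector \<omega>"
    using assms \<theta> by (simp add: exp_in_sector_iff)
  then show ?thesis
    using type_omega by (auto simp: op_of_type_def S_spectrum_def)
qed

lemma SL_ray_bound: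
  "\<exists>C>0. \<forall>w v. \<bar>Im w\<bar> = \<theta> \<longrightarrow> norm (SL lm rm D T (exp w, 0) v) \<le> C / exp (Re w) * norm v"
proof -
  \<comment> \<open>The type condition gives bounds only outside a closed sector, so its angle is
    chosen strictly between \<open>\<omega>\<close> and the angle of the rays.\<close>
  define \<eta> where "\<eta> = (\<omega> + \<theta>) / 2"
  have \<eta>: "\<omega> < \<eta>" "\<eta> < \<theta>" "\<eta> \<le> pi" using \<theta> by (auto simp: \<eta>_def)
  then obtain C where C: "C > 0" "\<And>s v. s \<noteq> 0 \<Longrightarrow> s \<notin> sector \<eta> \<Longrightarrow>
      norm (SL lm rm D T s v) \<le> C / norm s * norm v"
    using type_omega unfolding op_of_type_def by blast
  have "norm (SL lm rm D T (exp w, 0) v) \<le> C / exp (Re w) * norm v" if "\<bar>Im w\<bar> = \<theta>" for w v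
    using C(2)[of "(exp w, 0)" v] that \<eta> \<theta> by (simp add: exp_in_sector_iff norm_Pair zero_prod_def)
  with C(1) show ?thesis by blast
qed

lemma SL_conj_diff:
  assumes "(z, 0) \<in> \<rho>"
  shows "SL lm rm D T (cnj z, 0) x - SL lm rm D T (z, 0) x = Q (z, 0) (cl (z - cnj z) x)"
  by (simp add: SL_def Q_conj qcnj_def cl_diff Q_diff[OF assms])

text \<open>Since \<open>Q s\<close> only depends on the real part and the norm of \<open>s\<close>, it can be recovered
  from the resolvents at \<open>s\<close> and its conjugate.\<close>

lemma Q_ray_bound:
  "\<exists>M>0. \<forall>w v. \<bar>Im w\<bar> = \<theta> \<longrightarrow> norm (Q (exp w, 0) v) \<le> M / (exp (Re w))\<^sup>2 * norm v \<and>
     norm (T (Q (exp w, 0) v)) \<le> M / exp (Re w) * norm v"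
proof -
  obtain C where C: "C > 0" "\<And>w v. \<bar>Im w\<bar> = \<theta> \<Longrightarrow>
      norm (SL lm rm D T (exp w, 0) v) \<le> C / exp (Re w) * norm v"
    using SL_ray_bound by blast
  have sin: "sin \<theta> > 0" using \<theta> by (simp add: sin_gt_zero)
  \<comment> \<open>\<open>C / sin \<theta>\<close> bounds \<open>Q\<close>, because
    \<open>z - cnj z\<close> has norm \<open>2 * r * sin \<theta>\<close>; the additional
    \<open>C\<close> pays for the resolvent \<open>SL\<close> that appears when \<open>T Q\<close>
    is expressed through \<open>Q\<close> and \<open>SL\<close>.\<close>
  define M where "M = C + C / sin \<theta>"
  have M: "M > 0" "C / sin \<theta> \<le> M" using C(1) sin by (auto simp: M_def add_pos_pos)
  have "norm (Q (exp w, 0) v) \<le> M / (exp (Re w))\<^sup>2 * norm v \<and>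
     norm (T (Q (exp w, 0) v)) \<le> M / exp (Re w) * norm v" if w: "\<bar>Im w\<bar> = \<theta>" for w v
  proof -
    define z where "z = exp w"
    define r where "r = exp (Re w)"
    have s: "(z, 0) \<in> \<rho>" using ray_in_resolvent_set[OF w] by (simp add: z_def)
    have r: "r > 0" "norm z = r" by (auto simp: r_def z_def)
    have "Im z = r * sin (Im w)" by (simp add: z_def r_def Im_exp)
    moreover have "Im w = \<theta> \<or> Im w = - \<theta>" using w by linarith
    then have "\<bar>sin (Im w)\<bar> = sin \<theta>" using sin by auto
    ultimately have Im: "norm (z - cnj z) = 2 * r * sin \<theta>"
      using r by (simp add: complex_diff_cnj norm_mult abs_mult)
    have Cz: "norm (SL lm rm D T (z, 0) x) \<le> C / r * norm x" for x
      using C(2)[OF w] by (simp add: z_def r_def)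
    have Ccz: "norm (SL lm rm D T (cnj z, 0) x) \<le> C / r * norm x" for x
      using C(2)[of "cnj w"] w by (simp add: z_def r_def exp_cnj)
    have Q: "norm (Q (z, 0) v) \<le> C / sin \<theta> / r\<^sup>2 * norm v" for v
    proof -
      define x where "x = cl (1 / (z - cnj z)) v"
      have nz: "z - cnj z \<noteq> 0" using Im r sin by auto
      have "Q (z, 0) v = SL lm rm D T (cnj z, 0) x - SL lm rm D T (z, 0) x"
        unfolding SL_conj_diff[OF s] x_def using nz by (simp add: cl_1 flip: cl_mult)
      then have "norm (Q (z, 0) v) \<le> norm (SL lm rm D T (cnj z, 0) x) + norm (SL lm rm D T (z, 0) x)"
        by (simp add: norm_triangle_ineq4)
      also have "\<dots> \<le> C / r * norm x + C / r * norm x"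
        by (intro add_mono Cz Ccz)
      also have "norm x = norm v / (2 * r * sin \<theta>)"
        unfolding x_def norm_lm using Im r sin by (simp add: norm_Pair norm_divide abs_mult)
      finally show ?thesis using r sin by (simp add: field_simps power2_eq_square)
    qed
    have "T (Q (z, 0) v) = Q (z, 0) (cl (cnj z) v) - SL lm rm D T (z, 0) v"
      by (simp add: SL_def qcnj_def)
    then have "norm (T (Q (z, 0) v)) \<le> norm (Q (z, 0) (cl (cnj z) v)) + norm (SL lm rm D T (z, 0) v)"
      by (simp add: norm_triangle_ineq4)
    also have "\<dots> \<le> C / sin \<theta> / r\<^sup>2 * (r * norm v) + C / r * norm v"
      using Q[of "cl (cnj z) v"] Cz[of v] r(1) by (simp add: norm_lm norm_Pair r(2))
    also have "\<dots> = M / r * norm v"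
      using r sin by (simp add: M_def field_simps power2_eq_square)
    finally have TQ: "norm (T (Q (z, 0) v)) \<le> M / r * norm v" .
    have "C / sin \<theta> / r\<^sup>2 * norm v \<le> M / r\<^sup>2 * norm v"
      using M by (intro mult_right_mono divide_right_mono) auto
    with Q[of v] TQ show ?thesis unfolding z_def r_def by linarith
  qed
  with M(1) show ?thesis by blast
qed

abbreviation A :: "'v \<Rightarrow> 'v" where "A v \<equiv> T (Q qi v)"

lemma qi_in_resolvent_set: "qi \<in> \<rho>"
  using units qi_in_qS by blast

lemma bounded_linear_A: "bounded_linear A"
proof -
  \<comment> \<open>The point of modulus 1 on the upper ray, where the resolvent bounds hold; they
    are not given at \<open>qi\<close> itself.\<close>
  define w where "w = Complex 0 \<theta>"
  have w: "\<bar>Im w\<bar> = \<theta>" using \<theta> by (simp add: w_def)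
  obtain M where "\<forall>v. norm (T (Q (exp w, 0) v)) \<le> M / exp (Re w) * norm v"
    using Q_ray_bound w by blast
  then have "bounded_linear (\<lambda>v. T (Q (exp w, 0) v))"
    by (intro bounded_linear_intro[where K = "M / exp (Re w)"])
      (auto simp: TQ_add[OF ray_in_resolvent_set[OF w]] TQ_scaleR[OF ray_in_resolvent_set[OF w]] mult.commute)
  then show ?thesis
    by (rule bounded_linear_TQ_of_bounded[OF qi_in_resolvent_set ray_in_resolvent_set[OF w]])
qed

lemma inj_A: "inj A"
proof (rule linear_injective_0[THEN iffD2])
  show "linear A" using bounded_linear_A by (rule bounded_linear.linear)
  show "\<forall>v. A v = 0 \<longrightarrow> v = 0"
  proof (intro allI impI)
    fix v assume "A v = 0"
    then have "T (Q qi v) = T 0" by (simp add: T_0)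
    then have "Q qi v = 0"
      using Omega Q_in_D[OF qi_in_resolvent_set, of v] D_0 by (auto simp: op_in_Omega_def dest: inj_onD)
    then show "v = 0"
      using Qop_Q[OF qi_in_resolvent_set, of v] by (simp add: Qop_def T_0)
  qed
qed

abbreviation ray :: "real \<Rightarrow> real \<Rightarrow> complex" where "ray \<phi> r \<equiv> exp (Complex (ln r) \<phi>)"

text \<open>The resolvent identity writes \<open>q r (y r)\<close> as \<open>q a (y a)\<close> plus
  \<open>q r\<close> applied to a vector \<open>h r\<close> that tends to 0 as \<open>r\<close>
  tends to \<open>a\<close>. The ray bounds on \<open>Q\<close> and \<open>T Q\<close>, uniform near
  \<open>a\<close>, make the remainder vanish.\<close>

lemma continuous_on_SL_ray:
  assumes \<phi>: "\<bar>\<phi>\<bar> = \<theta>" and x: "continuous_on {0<..} x"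
  shows "continuous_on {0<..} (\<lambda>r. SL lm rm D T (ray \<phi> r, 0) (x r))"
proof -
  obtain M where M: "\<And>w v. \<bar>Im w\<bar> = \<theta> \<Longrightarrow> norm (Q (exp w, 0) v) \<le> M / (exp (Re w))\<^sup>2 * norm v"
     "\<And>w v. \<bar>Im w\<bar> = \<theta> \<Longrightarrow> norm (T (Q (exp w, 0) v)) \<le> M / exp (Re w) * norm v"
    using Q_ray_bound by blast
  define q where "q r = Q (ray \<phi> r, 0)" for r
  have s: "(ray \<phi> r, 0) \<in> \<rho>" for r
    using \<phi> by (intro ray_in_resolvent_set) simp
  have q_bound: "norm (q r v) \<le> M / r\<^sup>2 * norm v" "norm (T (q r v)) \<le> M / r * norm v"
    if "r > 0" for r v
    using M[of "Complex (ln r) \<phi>" v] \<phi> that by (simp_all add: q_def)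
  have cray: "continuous_on {0<..} (ray \<phi>)"
    by (intro continuous_intros continuous_on_Complex_ln)
  have *: "((\<lambda>r. q r (y r)) \<longlongrightarrow> q a (y a)) (at a within {0<..})"
      "((\<lambda>r. T (q r (y r))) \<longlongrightarrow> T (q a (y a))) (at a within {0<..})"
    if y: "continuous_on {0<..} y" and a: "a \<in> {0<..}" for a y
  proof -
    define u where "u r = (2 * (Re (ray \<phi> r) - Re (ray \<phi> a))) *\<^sub>R T (q a (y a))
       + ((norm (ray \<phi> a))\<^sup>2 - (norm (ray \<phi> r))\<^sup>2) *\<^sub>R q a (y a)" for r
    define h where "h r = y r - y a + u r" for r
    have qh: "q r (y r) = q a (y a) + q r (h r)" for r
    proof -
      have "q r (y a) - q a (y a) = q r (u r)"
        using Q_resolvent_identity[OF s[of r] s[of a], of "y a"]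
        by (simp add: u_def q_def qRe_def norm_Pair del: norm_exp_eq_Re)
      then show ?thesis
        by (simp add: h_def q_def Q_add[OF s] Q_diff[OF s] algebra_simps)
    qed
    have lim_y: "(y \<longlongrightarrow> y a) (at a within {0<..})" and lim_ray: "(ray \<phi> \<longlongrightarrow> ray \<phi> a) (at a within {0<..})"
      using y cray a by (auto simp: continuous_on_def)
    have "(h \<longlongrightarrow> y a - y a + ((2 * (Re (ray \<phi> a) - Re (ray \<phi> a))) *\<^sub>R T (q a (y a))
       + ((norm (ray \<phi> a))\<^sup>2 - (norm (ray \<phi> a))\<^sup>2) *\<^sub>R q a (y a))) (at a within {0<..})"
      unfolding h_def u_def by (intro tendsto_intros lim_y lim_ray)
    then have h: "(h \<longlongrightarrow> 0) (at a within {0<..})" by simp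
    have ev: "eventually (\<lambda>r. r \<in> {0<..}) (at a within {0<..})"
      by (simp add: eventually_at_filter)
    have "((\<lambda>r. M / r\<^sup>2 * norm (h r)) \<longlongrightarrow> M / a\<^sup>2 * norm (0::'v)) (at a within {0<..})"
      using a by (intro tendsto_intros h) auto
    then have "((\<lambda>r. M / r\<^sup>2 * norm (h r)) \<longlongrightarrow> 0) (at a within {0<..})" by simp
    then have "((\<lambda>r. q r (h r)) \<longlongrightarrow> 0) (at a within {0<..})"
      by (elim Lim_null_comparison[OF eventually_mono[OF ev], rotated]) (use q_bound in auto)
    then have "((\<lambda>r. q a (y a) + q r (h r)) \<longlongrightarrow> q a (y a) + 0) (at a within {0<..})"
      by (intro tendsto_intros)
    then show "((\<lambda>r. q r (y r)) \<longlongrightarrow> q a (y a)) (at a within {0<..})"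
      by (simp add: qh[symmetric])
    have "((\<lambda>r. M / r * norm (h r)) \<longlongrightarrow> M / a * norm (0::'v)) (at a within {0<..})"
      using a by (intro tendsto_intros h) auto
    then have "((\<lambda>r. M / r * norm (h r)) \<longlongrightarrow> 0) (at a within {0<..})" by simp
    then have "((\<lambda>r. T (q r (h r))) \<longlongrightarrow> 0) (at a within {0<..})"
      by (elim Lim_null_comparison[OF eventually_mono[OF ev], rotated]) (use q_bound in auto)
    then have "((\<lambda>r. T (q a (y a)) + T (q r (h r))) \<longlongrightarrow> T (q a (y a)) + 0) (at a within {0<..})"
      by (intro tendsto_intros)
    moreover have "T (q a (y a)) + T (q r (h r)) = T (q r (y r))" for r
      unfolding qh[of r] by (simp add: T_add q_def Q_in_D[OF s])
    ultimately show "((\<lambda>r. T (q r (y r))) \<longlongrightarrow> T (q a (y a))) (at a within {0<..})"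
      by simp
  qed
  have "continuous_on {0<..} (\<lambda>r. cl (cnj (ray \<phi> r)) (x r))"
    by (intro continuous_on_cl continuous_intros cray x)
  from *(1)[OF this] *(2)[OF x] show ?thesis
    unfolding continuous_on_def SL_def qcnj_def q_def
    by (auto intro!: tendsto_diff)
qed

end

section \<open>The functional calculus\<close>

text \<open>From here on symbols are written in the logarithmic coordinate \<open>w\<close> with \<open>s = exp w\<close>, which turns
  the slice of a sector into a horizontal strip.\<close>

definition strip_holomorphic :: "real \<Rightarrow> (complex \<Rightarrow> quat) \<Rightarrow> bool" where
  "strip_holomorphic \<mu> g \<longleftrightarrow> (\<lambda>w. fst (g w)) holomorphic_on strip \<mu> \<and> (\<lambda>w. snd (g w)) holomorphic_on strip \<mu>"

text \<open>The bound is imposed on the closed strip between the two rays rather than on the full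
  open strip: division by \<open>exp w + exp (- w)\<close> preserves it there by
  compactness.\<close>

definition strip_decaying :: "real \<Rightarrow> (complex \<Rightarrow> quat) \<Rightarrow> bool" where
  "strip_decaying \<theta> g \<longleftrightarrow>
    (\<exists>\<alpha>>0. \<exists>C. \<forall>w. \<bar>Im w\<bar> \<le> \<theta> \<longrightarrow> norm (g w) \<le> C * decay \<alpha> (exp (Re w)))"

lemma strip_holomorphic_mult:
  assumes "strip_holomorphic \<mu> g" "c holomorphic_on strip \<mu>"
  shows "strip_holomorphic \<mu> (\<lambda>w. qmul (c w, 0) (g w))"
  using assms by (auto simp: strip_holomorphic_def qmul_complex intro!: holomorphic_intros)

lemma strip_holomorphic_continuous:
  assumes "strip_holomorphic \<mu> g"
  shows "continuous_on (strip \<mu>) g"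
proof -
  have "continuous_on (strip \<mu>) (\<lambda>w. (fst (g w), snd (g w)))"
    using assms unfolding strip_holomorphic_def
    by (intro continuous_intros holomorphic_on_imp_continuous_on) auto
  then show ?thesis by simp
qed

lemma strip_integrals_agree_quat:
  assumes g: "strip_holomorphic \<mu> g" "strip_decaying \<theta> g" and \<theta>: "0 < \<theta>" "\<theta> < \<mu>"
  shows "\<exists>J. \<forall>\<phi>\<in>{\<theta>, - \<theta>}. ((\<lambda>r. (1 / r) *\<^sub>R g (Complex (ln r) \<phi>)) has_integral J) {0<..}"
proof -
  obtain \<alpha> C where \<alpha>: "\<alpha> > 0"
    and C: "\<And>w. \<bar>Im w\<bar> \<le> \<theta> \<Longrightarrow> norm (g w) \<le> C * decay \<alpha> (exp (Re w))"
    using g(2) unfolding strip_decaying_def by blast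
  have C': "norm (fst (g w)) \<le> C * decay \<alpha> (exp (Re w))" "norm (snd (g w)) \<le> C * decay \<alpha> (exp (Re w))"
    if "\<bar>Im w\<bar> \<le> \<theta>" for w
    using C[OF that] norm_fst_le[of "fst (g w)" "snd (g w)"] norm_snd_le[of "snd (g w)" "fst (g w)"] by auto
  obtain J1 J2 where J:
    "\<And>\<phi>. \<phi> \<in> {\<theta>, - \<theta>} \<Longrightarrow> ((\<lambda>r. fst (g (Complex (ln r) \<phi>)) / of_real r) has_integral J1) {0<..}"
    "\<And>\<phi>. \<phi> \<in> {\<theta>, - \<theta>} \<Longrightarrow> ((\<lambda>r. snd (g (Complex (ln r) \<phi>)) / of_real r) has_integral J2) {0<..}"
    using strip_boundary_integrals_agree[OF _ \<theta> \<alpha> C'(1)]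
      strip_boundary_integrals_agree[OF _ \<theta> \<alpha> C'(2)] g(1) unfolding strip_holomorphic_def by blast
  have "((\<lambda>r. (1 / r) *\<^sub>R g (Complex (ln r) \<phi>)) has_integral (J1, J2)) {0<..}"
    if "\<phi> \<in> {\<theta>, - \<theta>}" for \<phi>
  proof -
    have "bounded_linear (\<lambda>c. (c, 0) :: quat)" "bounded_linear (\<lambda>c. (0, c) :: quat)"
      by (intro bounded_linear_Pair bounded_linear_ident bounded_linear_zero)+
    from has_integral_add[OF has_integral_linear[OF J(1)[OF that] this(1)]
        has_integral_linear[OF J(2)[OF that] this(2)]]
    show ?thesis
      by (auto simp: o_def prod_eq_iff scaleR_conv_of_real divide_inverse mult.commute elim!: has_integral_eq[rotated])
  qed
  then show ?thesis by blast
qed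

text \<open>For \<open>\<bar>Re w\<bar> > ln 2\<close> the divisor dominates half of
  \<open>1 + exp (Re w)\<close>. The remaining rectangle is compact and contains any zeros of the
  divisor in the closed strip; there continuity of \<open>H\<close> suffices. Bounding
  \<open>(1 + exp (Re w)) * norm (H w)\<close> gives both conclusions at once.\<close>

lemma strip_decaying_quotient:
  assumes H: "strip_holomorphic \<mu> H" and G: "strip_decaying \<theta> G" and \<theta>: "0 < \<theta>" "\<theta> < \<mu>"
    and eq: "\<And>w. w \<in> strip \<mu> \<Longrightarrow> G w = qmul (exp w + exp (- w), 0) (H w)"
  shows "strip_decaying \<theta> H" and "strip_decaying \<theta> (\<lambda>w. qmul (exp w, 0) (H w))"
proof -
  obtain \<alpha> C where \<alpha>: "\<alpha> > 0"
    and C: "\<And>w. \<bar>Im w\<bar> \<le> \<theta> \<Longrightarrow> norm (G w) \<le> C * decay \<alpha> (exp (Re w))"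
    using G unfolding strip_decaying_def by blast
  define K where "K = cbox (Complex (- ln 2) (- \<theta>)) (Complex (ln 2) \<theta>)"
  define h where "h w = (1 + exp (Re w)) * norm (H w) / decay \<alpha> (exp (Re w))" for w
  have "continuous_on K h"
    unfolding h_def decay_def
    by (intro continuous_intros continuous_on_powr continuous_on_subset[OF strip_holomorphic_continuous[OF H]])
      (use \<theta> in \<open>auto simp: K_def in_cbox_complex_iff strip_def add_pos_pos add_nonneg_eq_0_iff\<close>)
  then have "compact (h ` K)"
    by (rule compact_continuous_image) (simp add: K_def)
  then have "bounded (h ` K)"
    by (rule compact_imp_bounded)
  then obtain M where "\<forall>y\<in>h ` K. \<bar>y\<bar> \<le> M"
    unfolding bounded_real by blast
  then have M: "h w \<le> M" if "w \<in> K" for w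
    using that by fastforce
  \<comment> \<open>\<open>2 * C\<close> serves the part where division is possible,
    \<open>M\<close> the compact rectangle.\<close>
  define C' where "C' = max (2 * C) M"
  have "(1 + exp (Re w)) * norm (H w) \<le> C' * decay \<alpha> (exp (Re w))" if w: "\<bar>Im w\<bar> \<le> \<theta>" for w
  proof (cases "\<bar>Re w\<bar> \<le> ln 2")
    case True
    then have "w \<in> K"
      using w by (auto simp: K_def in_cbox_complex_iff)
    then have "h w \<le> C'"
      using M[of w] by (simp add: C'_def le_max_iff_disj)
    then show ?thesis
      by (simp add: h_def divide_le_eq decay_pos)
  next
    case False
    define x where "x = exp (Re w)"
    have x: "x > 0" "exp (- Re w) = 1 / x" by (auto simp: x_def exp_minus inverse_eq_divide)
    have "\<bar>x - 1 / x\<bar> = \<bar>norm (exp w) - norm (- exp (- w))\<bar>"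
      using x by (simp add: x_def)
    also have "\<dots> \<le> norm (exp w + exp (- w))"
      using norm_triangle_ineq3[of "exp w" "- exp (- w)"] by simp
    finally have le: "\<bar>x - 1 / x\<bar> \<le> norm (exp w + exp (- w))" .
    have gt: "2 < a \<Longrightarrow> b < 1 / 2 \<Longrightarrow> 1 + a \<le> 2 * \<bar>a - b\<bar>" for a b :: real
      using abs_ge_self[of "a - b"] by argo
    have lt: "a < 1 / 2 \<Longrightarrow> 2 < b \<Longrightarrow> 1 + a \<le> 2 * \<bar>a - b\<bar>" for a b :: real
      using abs_ge_minus_self[of "a - b"] by argo
    have "1 + x \<le> 2 * \<bar>x - 1 / x\<bar>"
    proof (cases "Re w \<ge> 0")
      case True
      with False have "x > exp (ln 2)" unfolding x_def by (subst exp_less_cancel_iff) auto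
      then have "x > 2" by simp
      moreover from this have "1 / x < 1 / 2" by (simp add: field_simps)
      ultimately show ?thesis by (rule gt)
    next
      case neg: False
      with False have "x < exp (- ln 2)" unfolding x_def by (subst exp_less_cancel_iff) auto
      then have "x < 1 / 2" by (simp add: exp_minus)
      moreover from this have "1 / x > 2" using x by (simp add: field_simps)
      ultimately show ?thesis by (rule lt)
    qed
    then have "(1 + x) * norm (H w) \<le> 2 * norm (exp w + exp (- w)) * norm (H w)"
      using le by (intro mult_right_mono) auto
    also have "\<dots> = 2 * norm (G w)"
    proof -
      have "w \<in> strip \<mu>" using w \<theta> by (simp add: strip_def)
      then show ?thesis by (simp add: eq norm_qmul_complex)
    qed
    also have "\<dots> \<le> 2 * C * decay \<alpha> x"
      using C[OF w] by (simp add: x_def)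
    also have "\<dots> \<le> C' * decay \<alpha> x"
      by (intro mult_right_mono decay_nonneg) (simp add: C'_def)
    finally show ?thesis by (simp add: x_def)
  qed
  moreover have "norm (H w) \<le> (1 + exp (Re w)) * norm (H w)"
    "norm (qmul (exp w, 0) (H w)) \<le> (1 + exp (Re w)) * norm (H w)" for w
  proof -
    show "norm (H w) \<le> (1 + exp (Re w)) * norm (H w)"
      by (simp add: distrib_right)
    show "norm (qmul (exp w, 0) (H w)) \<le> (1 + exp (Re w)) * norm (H w)"
      by (simp add: norm_qmul_complex distrib_right)
  qed
  ultimately show "strip_decaying \<theta> H" and "strip_decaying \<theta> (\<lambda>w. qmul (exp w, 0) (H w))"
    unfolding strip_decaying_def using \<alpha> by (blast intro: order_trans)+
qed

section \<open>Contour integrals over the two rays\<close>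

context type_omega_operator
begin

text \<open>The factor \<open>- \<i> * cis \<phi>\<close> is \<open>ds_i / dr\<close> on the ray of
  angle \<open>\<phi>\<close>; the orientation of the contour enters as the sign in
  \<open>strip_calc\<close>.\<close>

definition ray_integrand :: "real \<Rightarrow> (complex \<Rightarrow> quat) \<Rightarrow> 'v \<Rightarrow> real \<Rightarrow> 'v" where
  "ray_integrand \<phi> g v r = SL lm rm D T (ray \<phi> r, 0) (cl (- \<i> * cis \<phi>) (lm (g (Complex (ln r) \<phi>)) v))"

definition strip_calc :: "(complex \<Rightarrow> quat) \<Rightarrow> 'v \<Rightarrow> 'v" where
  "strip_calc g v = (1 / (2 * pi)) *\<^sub>R
     (integral {0<..} (ray_integrand (- \<theta>) g v) - integral {0<..} (ray_integrand \<theta> g v))"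

lemma S_calc_eq_strip_calc:
  "S_calc lm rm D T \<omega> \<mu> \<psi> v = strip_calc (\<lambda>w. \<psi> (exp w, 0)) v"
proof -
  have e: "r *\<^sub>R (cis \<phi>, 0) = (ray \<phi> r, 0)" if "r > 0" for r \<phi>
    using that by (auto simp: complex_eq_iff Re_exp Im_exp)
  have c: "qexp \<phi> qi = (cis \<phi>, 0)" for \<phi>
    by (auto simp: qexp_def qof_real_def qi_def complex_eq_iff)
  have qi: "lm (qmul (- qi) (qmul (cis \<phi>, 0) q)) v = cl (- \<i> * cis \<phi>) (lm q v)" for \<phi> q
  proof -
    have "qmul (- qi) (qmul (cis \<phi>, 0) q) = qmul (- \<i> * cis \<phi>, 0) q"
      by (simp add: qi_def qmul_complex mult.assoc)
    then show ?thesis by (simp only: lm_qmul)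
  qed
  have "integral {0<..} (\<lambda>r. SL lm rm D T (r *\<^sub>R qexp \<phi> qi)
      (lm (qmul (- qi) (qmul (qexp \<phi> qi) (\<psi> (r *\<^sub>R qexp \<phi> qi)))) v))
    = integral {0<..} (ray_integrand \<phi> (\<lambda>w. \<psi> (exp w, 0)) v)" for \<phi>
    by (rule integral_cong) (simp only: e c qi ray_integrand_def greaterThan_iff)
  then show ?thesis
    by (simp add: S_calc_def strip_calc_def Let_def \<theta>_def)
qed

text \<open>The resolvent bound contributes exactly the factor \<open>1 / r\<close> that makes
  \<open>decay\<close> integrable on the half line.\<close>

lemma ray_integrand_integrable:
  assumes g: "strip_holomorphic \<mu> g" "strip_decaying \<theta> g" and \<phi>: "\<bar>\<phi>\<bar> = \<theta>"
  shows "ray_integrand \<phi> g v integrable_on {0<..}"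
proof -
  obtain \<alpha> C where \<alpha>: "\<alpha> > 0"
    and C: "\<And>w. \<bar>Im w\<bar> \<le> \<theta> \<Longrightarrow> norm (g w) \<le> C * decay \<alpha> (exp (Re w))"
    using g(2) unfolding strip_decaying_def by blast
  obtain M where M: "M > 0" "\<And>w v. \<bar>Im w\<bar> = \<theta> \<Longrightarrow>
      norm (SL lm rm D T (exp w, 0) v) \<le> M / exp (Re w) * norm v"
    using SL_ray_bound by blast
  show ?thesis
  proof (rule integrable_half_line_of_decay[OF _ \<alpha>])
    have "continuous_on {0<..} (\<lambda>r. g (Complex (ln r) \<phi>))"
      by (rule continuous_on_compose2[OF strip_holomorphic_continuous[OF g(1)] continuous_on_Complex_ln])
        (use \<phi> \<theta> in \<open>auto simp: strip_def\<close>)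
    then show "continuous_on {0<..} (ray_integrand \<phi> g v)"
      unfolding ray_integrand_def
      by (intro continuous_on_SL_ray[OF \<phi>] continuous_on_cl continuous_intros lm.continuous_on)
    fix r :: real assume r: "r > 0"
    have "norm (cl (- \<i> * cis \<phi>) (lm q v)) = norm q * norm v" for q
      by (simp add: norm_lm norm_Pair norm_mult)
    then have "norm (ray_integrand \<phi> g v r) \<le> M / r * (norm (g (Complex (ln r) \<phi>)) * norm v)"
      using M(2)[of "Complex (ln r) \<phi>" "cl (- \<i> * cis \<phi>) (lm (g (Complex (ln r) \<phi>)) v)"] \<phi> r
      unfolding ray_integrand_def by simp
    also have "\<dots> \<le> M / r * ((C * decay \<alpha> r) * norm v)"
      using C[of "Complex (ln r) \<phi>"] \<phi> r M(1) by (intro mult_left_mono mult_right_mono) auto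
    also have "\<dots> = (M * C * norm v) * decay \<alpha> r / r" by simp
    finally show "norm (ray_integrand \<phi> g v r) \<le> (M * C * norm v) * decay \<alpha> r / r" .
  qed
qed

text \<open>The resolvent identity expresses the integrand for \<open>H\<close> through the one for \<open>G\<close>
  and two terms free of the resolvent, whose contour integrals vanish by Cauchy's theorem.\<close>

lemma strip_calc_regularize:
  assumes G: "strip_holomorphic \<mu> G" "strip_decaying \<theta> G" and H: "strip_holomorphic \<mu> H"
    and eq: "\<And>w. w \<in> strip \<mu> \<Longrightarrow> G w = qmul (exp w + exp (- w), 0) (H w)"
  shows "strip_calc H v = A (strip_calc G v)"
proof -
  note dec = strip_decaying_quotient[OF H G(2) \<theta>(3,2) eq]
  have H': "strip_holomorphic \<mu> (\<lambda>w. qmul (exp w, 0) (H w))"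
    by (intro strip_holomorphic_mult H holomorphic_intros)
  obtain J1 J2 where
    J1: "\<And>\<phi>. \<phi> \<in> {\<theta>, - \<theta>} \<Longrightarrow> ((\<lambda>r. (1 / r) *\<^sub>R qmul (ray \<phi> r, 0) (H (Complex (ln r) \<phi>))) has_integral J1) {0<..}"
    and J2: "\<And>\<phi>. \<phi> \<in> {\<theta>, - \<theta>} \<Longrightarrow> ((\<lambda>r. (1 / r) *\<^sub>R H (Complex (ln r) \<phi>)) has_integral J2) {0<..}"
    using strip_integrals_agree_quat[OF H' dec(2) \<theta>(3,2)] strip_integrals_agree_quat[OF H dec(1) \<theta>(3,2)] by blast
  \<comment> \<open>The Cauchy integrals are quaternions; the bounded map \<open>L\<close> carries
    them into the Banach space and, like \<open>A\<close> and \<open>Q qi\<close>, passes through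
    the integral.\<close>
  define L where "L q = cl (- \<i>) (lm q v)" for q
  have L: "bounded_linear L"
    unfolding L_def
    by (rule bounded_linear_compose[OF lm.bounded_linear_right lm.bounded_linear_left])
  note A = bounded_linear_A and B = bounded_linear_Q[OF qi_in_resolvent_set]
  \<comment> \<open>\<open>J1\<close> and \<open>J2\<close> are the same for both rays, so the
    correction terms cancel in the difference that defines \<open>strip_calc\<close>.\<close>
  have int: "integral {0<..} (ray_integrand \<phi> H v) = A (integral {0<..} (ray_integrand \<phi> G v)) - A (L J1) + Q qi (L J2)"
    if \<phi>: "\<phi> \<in> {\<theta>, - \<theta>}" for \<phi>
  proof (rule integral_unique, rule has_integral_eq)
    have abs: "\<bar>\<phi>\<bar> = \<theta>" using \<phi> \<theta> by auto
    let ?p = "\<lambda>r. L ((1 / r) *\<^sub>R qmul (ray \<phi> r, 0) (H (Complex (ln r) \<phi>)))"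
    let ?q = "\<lambda>r. L ((1 / r) *\<^sub>R H (Complex (ln r) \<phi>))"
    have "((\<lambda>r. A (ray_integrand \<phi> G v r)) has_integral A (integral {0<..} (ray_integrand \<phi> G v))) {0<..}"
      using has_integral_linear[OF integrable_integral[OF ray_integrand_integrable[OF G abs]] A] by (simp add: o_def)
    moreover have "((\<lambda>r. A (?p r)) has_integral A (L J1)) {0<..}"
      using has_integral_linear[OF has_integral_linear[OF J1[OF \<phi>] L] A] by (simp add: o_def)
    moreover have "((\<lambda>r. Q qi (?q r)) has_integral Q qi (L J2)) {0<..}"
      using has_integral_linear[OF has_integral_linear[OF J2[OF \<phi>] L] B] by (simp add: o_def)
    ultimately show "((\<lambda>r. A (ray_integrand \<phi> G v r) - A (?p r) + Q qi (?q r)) has_integral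
        A (integral {0<..} (ray_integrand \<phi> G v)) - A (L J1) + Q qi (L J2)) {0<..}"
      by (intro has_integral_add has_integral_diff)
    fix r :: real assume "r \<in> {0<..}"
    then have r: "r > 0" by simp
    define w where "w = Complex (ln r) \<phi>"
    define z where "z = exp w"
    have s: "(z, 0) \<in> \<rho>"
      using ray_in_resolvent_set[of w] abs by (simp add: z_def w_def)
    have z: "z = of_real r * cis \<phi>"
      using r by (auto simp: z_def w_def complex_eq_iff Re_exp Im_exp)
    have z0: "z \<noteq> 0" by (simp add: z_def)
    define x where "x = cl (- \<i> * cis \<phi>) (lm (H w) v)"
    \<comment> \<open>Since \<open>z + 1 / z = (1 + z^2) / z\<close>, dividing by \<open>z\<close>
      brings the integrand for \<open>G\<close> into the form required by
      \<open>regularizer_SL\<close>.\<close>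
    define u where "u = cl (1 / z) x"
    have zu: "cl z u = x"
      using z0 by (simp add: u_def cl_1 flip: cl_mult)
    have "w \<in> strip \<mu>" using abs \<theta> by (simp add: w_def strip_def)
    from eq[OF this] have "lm (G w) v = cl (z + 1 / z) (lm (H w) v)"
      by (simp add: lm_qmul z_def exp_minus inverse_eq_divide)
    moreover have "(1 + z\<^sup>2) * (1 / z * c) = c * (z + 1 / z)" for c
      using z0 by (simp add: field_simps power2_eq_square)
    ultimately have Gu: "cl (- \<i> * cis \<phi>) (lm (G w) v) = cl (1 + z\<^sup>2) u"
      by (simp only: u_def x_def flip: cl_mult)
    \<comment> \<open>Dividing \<open>z = r * cis \<phi>\<close> by \<open>r\<close> leaves the
      factor \<open>cis \<phi>\<close> of the line element.\<close>
    have p: "?p r = x"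
    proof -
      have "?p r = cl (- \<i>) (cl (of_real (1 / r)) (cl z (lm (H w) v)))"
        by (simp only: L_def cl_of_real lm.scaleR_left lm_qmul z_def w_def)
      also have "\<dots> = x"
        using r by (simp add: x_def z mult.assoc flip: cl_mult)
      finally show ?thesis .
    qed
    have q: "?q r = u"
    proof -
      have "?q r = cl (- \<i>) (cl (of_real (1 / r)) (lm (H w) v))"
        by (simp only: L_def cl_of_real lm.scaleR_left w_def)
      also have "\<dots> = u"
        using r by (simp add: u_def x_def z mult.assoc flip: cl_mult)
      finally show ?thesis .
    qed
    have "A (ray_integrand \<phi> G v r) = ray_integrand \<phi> H v r + A x - Q qi u"
      unfolding ray_integrand_def w_def[symmetric] z_def[symmetric] Gu x_def[symmetric]
      using regularizer_SL[OF s qi_in_resolvent_set, of u] by (simp only: zu)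
    then show "A (ray_integrand \<phi> G v r) - A (?p r) + Q qi (?q r) = ray_integrand \<phi> H v r"
      unfolding p q by simp
  qed
  have "strip_calc H v = (1 / (2 * pi)) *\<^sub>R
      (A (integral {0<..} (ray_integrand (- \<theta>) G v)) - A (integral {0<..} (ray_integrand \<theta> G v)))"
    by (simp add: strip_calc_def int)
  also have "\<dots> = A (strip_calc G v)"
    by (simp only: strip_calc_def TQ_diff[OF qi_in_resolvent_set] TQ_scaleR[OF qi_in_resolvent_set])
  finally show ?thesis .
qed

text \<open>One factor is removed at a time. Decay of \<open>H\<close> is part of the induction
  because only its holomorphy is given, while each further step needs a decaying symbol to start
  from.\<close>

lemma strip_calc_regularize_power:
  assumes "strip_holomorphic \<mu> G" "strip_decaying \<theta> G" "strip_holomorphic \<mu> H"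
    and "\<And>w. w \<in> strip \<mu> \<Longrightarrow> G w = qmul ((exp w + exp (- w)) ^ d, 0) (H w)"
  shows "strip_decaying \<theta> H \<and> strip_calc H v = (A ^^ d) (strip_calc G v)"
  using assms(3,4)
proof (induction d arbitrary: H)
  case 0
  then have GH: "G w = H w" if "w \<in> strip \<mu>" for w
    using that by (simp add: qmul_complex)
  have "ray_integrand \<phi> H v = ray_integrand \<phi> G v" if "\<bar>\<phi>\<bar> = \<theta>" for \<phi>
    using that \<theta> by (auto simp: ray_integrand_def strip_def GH)
  then have "strip_calc H v = strip_calc G v"
    using \<theta> by (simp add: strip_calc_def)
  moreover have "strip_decaying \<theta> H"
    using assms(2) GH \<theta> unfolding strip_decaying_def strip_def by (metis (mono_tags) mem_Collect_eq le_less_trans)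
  ultimately show ?case by simp
next
  case (Suc d)
  let ?H' = "\<lambda>w. qmul (exp w + exp (- w), 0) (H w)"
  have H': "strip_holomorphic \<mu> ?H'"
    by (intro strip_holomorphic_mult Suc.prems holomorphic_intros)
  moreover have "G w = qmul ((exp w + exp (- w)) ^ d, 0) (?H' w)" if "w \<in> strip \<mu>" for w
    using Suc.prems(2)[OF that] by (simp add: qmul_complex mult_ac)
  ultimately have IH: "strip_decaying \<theta> ?H'" "strip_calc ?H' v = (A ^^ d) (strip_calc G v)"
    using Suc.IH[of ?H'] by auto
  show ?case
    using strip_decaying_quotient(1)[OF Suc.prems(1) IH(1) \<theta>(3,2)] strip_calc_regularize[OF H' IH(1) Suc.prems(1)]
      IH(2) by simp
qed

end

text \<open>On the slice of \<open>qi\<close> the defining equation makes the differential complex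
  linear for left multiplication. This acts separately on the two complex components, so each is
  holomorphic, and composition with \<open>exp\<close> moves them to the strip.\<close>

lemma left_slice_hol_imp_strip_holomorphic:
  assumes hol: "left_slice_hol (sector0 \<mu>) \<psi>" and \<mu>: "\<mu> \<le> pi"
  shows "strip_holomorphic \<mu> (\<lambda>w. \<psi> (exp w, 0))"
proof -
  let ?U = "sector0 \<mu>"
  have *: "(\<lambda>z. fst (\<psi> (z, 0))) field_differentiable at p \<and> (\<lambda>z. snd (\<psi> (z, 0))) field_differentiable at p"
    if p: "(p, 0) \<in> ?U" for p
  proof -
    have "\<psi> differentiable at (p, 0)"
      using hol p by (auto simp: left_slice_hol_def differentiable_on_def at_within_open[of "(p, 0)" ?U])
    then obtain L where L: "(\<psi> has_derivative L) (at (p, 0))"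
      by (auto simp: differentiable_def)
    interpret L: bounded_linear L using L by (rule has_derivative_bounded_linear)
    have "((\<lambda>z::complex. (z, 0::complex)) has_derivative (\<lambda>h. (h, 0))) (at p)"
      by (auto intro!: derivative_eq_intros)
    from has_derivative_compose[OF this L]
    have der: "((\<lambda>z. \<psi> (z, 0)) has_derivative (\<lambda>h. L (h, 0))) (at p)" .
    have line: "((\<lambda>t. \<psi> (a + of_real t * b, 0)) has_vector_derivative L (b, 0)) (at t)"
      if "a + of_real t * b = p" for a b t
    proof -
      have "((\<lambda>t. a + of_real t * b) has_derivative (\<lambda>h. of_real h * b)) (at t)"
        by (auto intro!: derivative_eq_intros)
      from has_derivative_compose[OF this, of "\<lambda>z. \<psi> (z, 0)"] der that
      have "((\<lambda>t. \<psi> (a + of_real t * b, 0)) has_derivative (\<lambda>h. L (of_real h * b, 0))) (at t)"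
        by simp
      moreover have "L (of_real h * b, 0) = h *\<^sub>R L (b, 0)" for h
        using L.scaleR[of h "(b, 0)"] by (simp add: scaleR_conv_of_real)
      ultimately show ?thesis by (simp add: has_vector_derivative_def)
    qed
    have pt: "slice_pt qi u v = (Complex u v, 0)" for u v
      by (simp add: slice_pt_def qof_real_def qi_def complex_eq_iff)
    have "vector_derivative (\<lambda>t. \<psi> (slice_pt qi t (Im p))) (at (Re p)) = L (1, 0)"
      using line[of "\<i> * of_real (Im p)" "Re p" 1]
      by (intro vector_derivative_at) (simp add: pt complex_eq_iff Complex_eq add.commute)
    moreover have "vector_derivative (\<lambda>t. \<psi> (slice_pt qi (Re p) t)) (at (Im p)) = L (\<i>, 0)"
      using line[of "of_real (Re p)" "Im p" \<i>]
      by (intro vector_derivative_at) (simp add: pt complex_eq_iff Complex_eq mult.commute)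
    moreover have "slice_pt qi (Re p) (Im p) \<in> ?U"
      using p by (simp add: pt)
    ultimately have CR: "L (1, 0) + qmul qi (L (\<i>, 0)) = 0"
      using hol qi_in_qS(1) unfolding left_slice_hol_def by force
    \<comment> \<open>Multiplying the equation \<open>CR\<close> by \<open>qi\<close> gives the
      value of \<open>L\<close> on the imaginary direction; real linearity does the rest.\<close>
    have Lh: "L (h, 0) = qmul (h, 0) (L (1, 0))" for h
    proof -
      have "L (\<i>, 0) = qmul qi (L (1, 0))"
        using CR by (auto simp: qi_def qmul_complex prod_eq_iff algebra_simps add_eq_0_iff complex_eq_iff)
      moreover have "(h, 0 :: complex) = Re h *\<^sub>R (1, 0) + Im h *\<^sub>R (\<i>, 0)"
        by (simp add: complex_eq_iff)
      then have "L (h, 0) = Re h *\<^sub>R L (1, 0) + Im h *\<^sub>R L (\<i>, 0)"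
        by (simp only: L.add L.scaleR)
      ultimately show ?thesis
        by (simp add: qi_def qmul_complex prod_eq_iff complex_eq_iff)
    qed
    have "(\<lambda>h. L (h, 0)) = (\<lambda>h. qmul (h, 0) (L (1, 0)))"
      by (rule ext) (rule Lh)
    with der have der': "((\<lambda>z. \<psi> (z, 0)) has_derivative (\<lambda>h. qmul (h, 0) (L (1, 0)))) (at p)"
      by (rule back_subst[where P = "\<lambda>L. (_ has_derivative L) _"])
    have "((\<lambda>z. fst (\<psi> (z, 0))) has_derivative (\<lambda>h. fst (L (1, 0)) * h)) (at p)"
      "((\<lambda>z. snd (\<psi> (z, 0))) has_derivative (\<lambda>h. snd (L (1, 0)) * h)) (at p)"
      using has_derivative_fst[OF der'] has_derivative_snd[OF der']
      by (simp_all add: qmul_complex mult.commute)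
    then have "((\<lambda>z. fst (\<psi> (z, 0))) has_field_derivative fst (L (1, 0))) (at p)"
      "((\<lambda>z. snd (\<psi> (z, 0))) has_field_derivative snd (L (1, 0))) (at p)"
      by (auto simp: has_field_derivative_def)
    then show ?thesis
      unfolding field_differentiable_def by blast
  qed
  have "(exp w, 0) \<in> ?U" if "w \<in> strip \<mu>" for w
    using that \<mu> by (simp add: exp_in_sector0_iff strip_def)
  moreover have comp: "(\<lambda>w. g (exp w)) field_differentiable at w within S"
    if "g field_differentiable at (exp w)" for g :: "complex \<Rightarrow> complex" and w S
    using field_differentiable_compose_within[OF field_differentiable_within_exp
        field_differentiable_at_within[OF that]] by (simp add: o_def)
  ultimately show ?thesis
    unfolding strip_holomorphic_def holomorphic_on_def
    using * comp[of "\<lambda>z. fst (\<psi> (z, 0))"] comp[of "\<lambda>z. snd (\<psi> (z, 0))"] by blast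
qed

section \<open>The regularizers on the complex slice\<close>

lemma qpow_complex: "qpow (z, 0) n = (z ^ n, 0)"
  by (induction n) (simp_all add: qpow_def qone_def qof_real_def qmul_complex)

lemma qinv_complex: "qinv (z, 0) = (1 / z, 0)"
  using complex_div_cnj[of 1 z]
  by (simp add: qinv_def qcnj_def norm_Pair scaleR_conv_of_real)

lemma psi_fun_complex: "psi_fun k (z, 0) = ((z / (1 + z\<^sup>2)) ^ (k + 1), 0)"
  by (simp add: psi_fun_def qpow_complex qmul_complex qinv_complex qone_def qof_real_def power2_eq_square
      del: power_Suc)

text \<open>The base \<open>z / (1 + z^2)\<close> of the regularizers is the reciprocal of
  \<open>z + 1 / z\<close>. With \<open>z = exp w\<close> this is the relation between
  \<open>G\<close> and \<open>H\<close> required above.\<close>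

lemma psi_fun_add:
  assumes "z \<noteq> 0"
  shows "qmul (psi_fun k (z, 0)) q = qmul ((z + 1 / z) ^ d, 0) (qmul (psi_fun (k + d) (z, 0)) q)"
proof (cases "1 + z\<^sup>2 = 0")
  \<comment> \<open>At the imaginary units division by zero gives 0, so both regularizers vanish
    there and the identity persists.\<close>
  case True
  then show ?thesis by (simp add: psi_fun_complex qmul_complex)
next
  case False
  have "z + 1 / z = (1 + z\<^sup>2) / z"
    using assms by (simp add: field_simps power2_eq_square)
  then have "(z + 1 / z) * (z / (1 + z\<^sup>2)) = 1"
    using assms False by simp
  then have "(z + 1 / z) ^ d * (z / (1 + z\<^sup>2)) ^ d = 1"
    by (simp flip: power_mult_distrib)
  then have "(z / (1 + z\<^sup>2)) ^ (k + 1) = (z + 1 / z) ^ d * (z / (1 + z\<^sup>2)) ^ (k + d + 1)"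
    by (simp add: power_add)
  then show ?thesis
    by (simp only: psi_fun_complex qmul_complex fst_conv snd_conv mult.assoc)
qed

section \<open>Comparison of two regularizers\<close>

context type_omega_operator
begin

lemma psi_op_eq: "psi_op rm D T k = A ^^ (k + 1)"
  by (simp add: psi_op_def del: funpow.simps)

lemma Psi_L_strip:
  assumes "\<psi> \<in> Psi_L \<mu>"
  shows "strip_holomorphic \<mu> (\<lambda>w. \<psi> (exp w, 0))" and "strip_decaying \<theta> (\<lambda>w. \<psi> (exp w, 0))"
proof -
  show "strip_holomorphic \<mu> (\<lambda>w. \<psi> (exp w, 0))"
    using assms \<mu>_le by (intro left_slice_hol_imp_strip_holomorphic) (auto simp: Psi_L_def)
  obtain \<alpha> c where \<alpha>: "\<alpha> > 0"
    and c: "\<And>s. s \<in> sector0 \<mu> \<Longrightarrow> norm (\<psi> s) \<le> c * norm s powr \<alpha> / (1 + norm s powr (2 * \<alpha>))"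
    using assms unfolding Psi_L_def by blast
  have "norm (\<psi> (exp w, 0)) \<le> c * decay \<alpha> (exp (Re w))" if "\<bar>Im w\<bar> \<le> \<theta>" for w
    using c[of "(exp w, 0)"] that \<theta> by (simp add: exp_in_sector0_iff norm_Pair decay_def)
  with \<alpha> show "strip_decaying \<theta> (\<lambda>w. \<psi> (exp w, 0))"
    unfolding strip_decaying_def by blast
qed

text \<open>Both the regularized operator and the regularizer acquire the same left factor
  \<open>A ^^ d\<close>. As this factor is injective, membership in the range is unaffected and the
  preimages coincide.\<close>

lemma Hinf_calc_add:
  assumes "admissible \<mu> k f" "admissible \<mu> (k + d) f"
  shows "Hinf_calc lm rm D T \<omega> \<mu> k f = Hinf_calc lm rm D T \<omega> \<mu> (k + d) f"
proof
  fix v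
  let ?\<psi> = "\<lambda>k s. qmul (psi_fun k s) (f s)"
  let ?w = "\<lambda>k. S_calc lm rm D T \<omega> \<mu> (?\<psi> k) v"
  note adm = assms[unfolded admissible_def]
  have w: "?w (k + d) = (A ^^ d) (?w k)"
    unfolding S_calc_eq_strip_calc
    using strip_calc_regularize_power[OF Psi_L_strip[OF adm(1)] Psi_L_strip(1)[OF adm(2)], of d v]
      psi_fun_add[of "exp _" k _ d]
    by (simp add: exp_minus inverse_eq_divide)
  \<comment> \<open>This order of the summands makes \<open>funpow_add\<close> place
    \<open>A ^^ d\<close> outermost.\<close>
  have "k + d + 1 = d + (k + 1)" by simp
  then have P: "psi_op rm D T (k + d) u = (A ^^ d) (psi_op rm D T k u)" for u
    by (simp only: psi_op_eq funpow_add o_apply)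
  have inj: "inj (A ^^ n)" for n
    by (rule inj_fn[OF inj_A])
  then have inj_psi: "inj (psi_op rm D T n)" for n
    by (simp only: psi_op_eq)
  show "Hinf_calc lm rm D T \<omega> \<mu> k f v = Hinf_calc lm rm D T \<omega> \<mu> (k + d) f v"
  proof (cases "?w k \<in> range (psi_op rm D T k)")
    case True
    then obtain u where u: "?w k = psi_op rm D T k u" by blast
    then have "?w (k + d) = psi_op rm D T (k + d) u" by (simp only: w P)
    with u show ?thesis
      by (simp add: Hinf_calc_def inv_f_f[OF inj_psi])
  next
    case False
    then have "?w (k + d) \<notin> range (psi_op rm D T (k + d))"
      unfolding w using P inj[of d] by (auto dest: injD)
    with False show ?thesis
      by (simp add: Hinf_calc_def)
  qed
qed

end

theorem theorem5p5:
  fixes lm :: "quat \<Rightarrow> 'v::banach \<Rightarrow> 'v" and rm :: "'v \<Rightarrow> quat \<Rightarrow> 'v"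
    and D :: "'v set" and T :: "'v \<Rightarrow> 'v"
    and \<omega> \<mu> :: real and f :: "quat \<Rightarrow> quat" and k k' :: nat
  assumes "two_sided_qbanach lm rm"
    and "0 \<le> \<omega>" and "\<omega> < \<mu>" and "\<mu> \<le> pi"
    and "op_in_Omega lm rm D T \<omega>"
    and "qS \<subseteq> S_resolvent_set rm D T"
    and "f \<in> F_L \<mu>"
    and "admissible \<mu> k f" and "admissible \<mu> k' f"
  shows "Hinf_calc lm rm D T \<omega> \<mu> k f = Hinf_calc lm rm D T \<omega> \<mu> k' f"
proof -
  interpret type_omega_operator lm rm D T \<omega> \<mu>
    using assms by unfold_locales (auto simp: op_in_Omega_def op_of_type_def)
  show ?thesis
  proof (cases "k \<le> k'")
    case True
    then obtain d where "k' = k + d" using le_Suc_ex by blast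
    then show ?thesis using Hinf_calc_add assms by blast
  next
    case False
    then obtain d where "k = k' + d" using le_Suc_ex nat_le_linear by blast
    then show ?thesis using Hinf_calc_add assms by metis
  qed
qed

end
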